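(* If $\mathrm{Th}_{\mathcal{L}_R}(\mathcal{U}_\mathcal{R})$ eliminates quantifiers then it is axiomatized by $T_{ax}(\mathcal{R})$.
   Context: $\mathcal{R}=(R,\oplus,\leq,0)$ is a countable distance monoid (total order, $r\leq r\oplus s$, monotone, commutative, associative, identity $0$); $\mathcal{L}_R=\{d(x,y)\leq s:s\in R\}$; $\mathcal{U}_\mathcal{R}$ is the Fraïssé limit of finite $\mathcal{R}$-metric spaces with distances in $R$, as an $\mathcal{L}_R$-structure. $R^*$ is the set of cuts of $R$ (upward-closed subsets, containing $\max R$ if it exists) ordered by reverse inclusion, with maximum $\omega_R$ and $\alpha\oplus\beta=\inf\{r\oplus s:r,s\in R,\alpha\leq r,\beta\leq s\}$. $T_{MS}$ consists of: $\forall x\forall y(d(x,y)\leq 0\leftrightarrow x=y)$; symmetry $\forall x\forall y(d(x,y)\leq s\leftrightarrow d(y,x)\leq s)$ for $s\in R$; for $r,s,t\in R$ with no $x\in R$ satisfying $t<x\leq r\oplus s$, $\forall x\forall y\forall z((d(x,y)\leq r\wedge d(y,z)\leq s)\to d(x,z)\leq t)$; and $\forall x\forall y\, d(x,y)\leq \max R$ if $R$ has a maximum. An extension scheme is $(\mathcal{A},f,\Psi)$ with $\mathcal{A}$ a finite $R^*$-metric space, $f:A\to R^*$ with $f(a)>0$ and $(d_A(x,y),f(x),f(y))$ an $R^*$-triangle for all $x,y$ ($\mathcal{A}^f$ = $\mathcal{A}$ plus a point $z_f$ at distances $f$), and $\Psi$ an $R$-approximation of $\mathcal{A}^f$: a symmetric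 map assigning to each pair $(a,b)$ a set in $\{\{0\}\}\cup\{(r,s]:r\in R, s\in R\cup\{\omega_R\}, r<s\}$ containing $d(a,b)$. For $R$-approximations $\Phi$ of $\mathcal{A}^f$ with $A=\{a_1,\dots,a_n\}$, $\epsilon^\Phi_\mathcal{A}$ is $\forall\bar x\big(\bigwedge_{i,j}d(x_i,x_j)\in\Phi(a_i,a_j)\to\exists y\bigwedge_i d(x_i,y)\in\Phi(a_i,z_f)\big)$, where $d(x,y)\in(r,s]$ means $r<d(x,y)\leq s$ (or $d(x,y)>r$ if $s=\omega_R\notin R$) and $d(x,y)\in\{0\}$ means $x=y$. Assuming quantifier elimination, for each extension scheme there is $\Phi$ refining $\Psi$ (i.e. $\Phi(a,b)\subseteq\Psi(a,b)$) with $\mathcal{U}_\mathcal{R}\models\epsilon^\Phi_\mathcal{A}$; set $\epsilon(\mathcal{A},f,\Psi):=\epsilon^\Phi_\mathcal{A}$, and $T_{ax}(\mathcal{R})=T_{MS}\cup\{\epsilon(\mathcal{A},f,\Psi):(\mathcal{A},f,\Psi)\text{ an extension scheme}\}$. *)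

theory Defs
  imports "HOL-Library.Countable_Set"
begin

section \<open>Distance monoids and generalized metric spaces\<close>

class distance_monoid = linorder + comm_monoid_add +
  assumes le_add_dist: "r \<le> r + s"
    and add_mono_dist: "r \<le> t \<Longrightarrow> s \<le> u \<Longrightarrow> r + s \<le> t + u"

definition metric_on :: "'a set \<Rightarrow> ('a \<Rightarrow> 'a \<Rightarrow> 'r::distance_monoid) \<Rightarrow> bool" where
  "metric_on A d \<longleftrightarrow>
     (\<forall>x\<in>A. \<forall>y\<in>A. d x y = 0 \<longleftrightarrow> x = y) \<and>
     (\<forall>x\<in>A. \<forall>y\<in>A. d x y = d y x) \<and>
     (\<forall>x\<in>A. \<forall>y\<in>A. \<forall>z\<in>A. d x z \<le> d x y + d y z)"

definition triangle :: "'r::distance_monoid \<Rightarrow> 'r \<Rightarrow> 'r \<Rightarrow> bool" where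
  "triangle a b c \<longleftrightarrow> a \<le> b + c \<and> b \<le> a + c \<and> c \<le> a + b"


section \<open>The distance monoid of cuts\<close>

text \<open>The type of cuts over \<open>'r\<close> is written \<open>R\<^sup>*\<close> in comments.  A cut is an upward closed set
  containing the maximum of \<open>'r\<close>, if there is one; the empty set is thus a cut exactly
  if \<open>'r\<close> has no maximum.  Cuts are ordered by reverse inclusion.\<close>

typedef (overloaded) 'r cut =
  "{X :: 'r::distance_monoid set.
      (\<forall>r\<in>X. \<forall>s. r \<le> s \<longrightarrow> s \<in> X) \<and> (\<forall>m. (\<forall>r. r \<le> m) \<longrightarrow> m \<in> X)}"
  morphisms cut_set Cut
  by (rule exI[of _ UNIV]) auto

setup_lifting type_definition_cut

lemma cut_up: "r \<in> cut_set \<alpha> \<Longrightarrow> r \<le> s \<Longrightarrow> s \<in> cut_set \<alpha>"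
  using cut_set[of \<alpha>] by auto

lemma cut_max: "(\<And>r. r \<le> m) \<Longrightarrow> m \<in> cut_set \<alpha>"
  using cut_set[of \<alpha>] by auto

text \<open>The canonical embedding of \<open>'r\<close> into the cuts; an element \<open>r\<close> is identified with the set
  of its upper bounds.\<close>

lift_definition emb :: "'r::distance_monoid \<Rightarrow> 'r cut" is "\<lambda>r. {s. r \<le> s}"
  by auto

instantiation cut :: (distance_monoid) complete_linorder
begin

lift_definition less_eq_cut :: "'a cut \<Rightarrow> 'a cut \<Rightarrow> bool" is "\<lambda>X Y. Y \<subseteq> X" .

definition less_cut :: "'a cut \<Rightarrow> 'a cut \<Rightarrow> bool" where
  "less_cut \<alpha> \<beta> \<longleftrightarrow> \<alpha> \<le> \<beta> \<and> \<not> \<beta> \<le> \<alpha>"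

lift_definition inf_cut :: "'a cut \<Rightarrow> 'a cut \<Rightarrow> 'a cut" is "\<lambda>X Y. X \<union> Y"
  by auto

lift_definition sup_cut :: "'a cut \<Rightarrow> 'a cut \<Rightarrow> 'a cut" is "\<lambda>X Y. X \<inter> Y"
  by auto

lift_definition Inf_cut :: "'a cut set \<Rightarrow> 'a cut" is "\<lambda>C. \<Union> C \<union> {m. \<forall>r. r \<le> m}"
  subgoal premises C for C
  proof -
    have "s \<in> \<Union> C" if "r \<in> \<Union> C" "r \<le> s" for r s
      using C that by blast
    moreover have "\<forall>x. x \<le> s" if "\<forall>x. x \<le> r" "r \<le> s" for r s :: 'a
      using that order_trans by blast
    ultimately show ?thesis
      by blast
  qed
  done

lift_definition Sup_cut :: "'a cut set \<Rightarrow> 'a cut" is "\<lambda>C. \<Inter> C"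
  by auto

lift_definition bot_cut :: "'a cut" is UNIV
  by auto

text \<open>The maximal cut \<open>top\<close> is denoted \<open>\<omega>\<close> in comments.\<close>

lift_definition top_cut :: "'a cut" is "{m. \<forall>r. r \<le> m}"
  by (auto intro: order_trans)

instance
proof
  fix \<alpha> \<beta> \<gamma> :: "'a cut" and C :: "'a cut set"
  show "\<alpha> < \<beta> \<longleftrightarrow> \<alpha> \<le> \<beta> \<and> \<not> \<beta> \<le> \<alpha>" by (rule less_cut_def)
  note le = less_eq_cut.rep_eq
  show "\<alpha> \<le> \<alpha>" by (simp add: le)
  show "\<alpha> \<le> \<beta> \<Longrightarrow> \<beta> \<le> \<gamma> \<Longrightarrow> \<alpha> \<le> \<gamma>" by (auto simp: le)
  show "\<alpha> \<le> \<beta> \<Longrightarrow> \<beta> \<le> \<alpha> \<Longrightarrow> \<alpha> = \<beta>" by (auto simp: le cut_set_inject[symmetric])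
  show "\<alpha> \<le> \<beta> \<or> \<beta> \<le> \<alpha>"
  proof (rule ccontr)
    assume "\<not> (\<alpha> \<le> \<beta> \<or> \<beta> \<le> \<alpha>)"
    then obtain r s where "r \<in> cut_set \<alpha>" "r \<notin> cut_set \<beta>" "s \<in> cut_set \<beta>" "s \<notin> cut_set \<alpha>"
      unfolding less_eq_cut.rep_eq by blast
    then show False
      using cut_up linear[of r s] by blast
  qed
  show "inf \<alpha> \<beta> \<le> \<alpha>" "inf \<alpha> \<beta> \<le> \<beta>" by (auto simp: le inf_cut.rep_eq)
  show "\<alpha> \<le> \<beta> \<Longrightarrow> \<alpha> \<le> \<gamma> \<Longrightarrow> \<alpha> \<le> inf \<beta> \<gamma>" by (auto simp: le inf_cut.rep_eq)
  show "\<alpha> \<le> sup \<alpha> \<beta>" "\<beta> \<le> sup \<alpha> \<beta>" by (auto simp: le sup_cut.rep_eq)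
  show "\<beta> \<le> \<alpha> \<Longrightarrow> \<gamma> \<le> \<alpha> \<Longrightarrow> sup \<beta> \<gamma> \<le> \<alpha>" by (auto simp: le sup_cut.rep_eq)
  show "\<alpha> \<in> C \<Longrightarrow> Inf C \<le> \<alpha>" by (auto simp: le Inf_cut.rep_eq)
  show "(\<And>\<beta>. \<beta> \<in> C \<Longrightarrow> \<alpha> \<le> \<beta>) \<Longrightarrow> \<alpha> \<le> Inf C" by (auto simp: le Inf_cut.rep_eq cut_max)
  show "\<alpha> \<in> C \<Longrightarrow> \<alpha> \<le> Sup C" by (auto simp: le Sup_cut.rep_eq)
  show "(\<And>\<beta>. \<beta> \<in> C \<Longrightarrow> \<beta> \<le> \<alpha>) \<Longrightarrow> Sup C \<le> \<alpha>" by (auto simp: le Sup_cut.rep_eq)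
  show "Inf {} = (top :: 'a cut)" by transfer simp
  show "Sup {} = (bot :: 'a cut)" by transfer simp
qed

end

lemma cut_le_iff: "\<alpha> \<le> \<beta> \<longleftrightarrow> cut_set \<beta> \<subseteq> cut_set \<alpha>"
  by (rule less_eq_cut.rep_eq)

lemma le_emb_iff: "\<alpha> \<le> emb r \<longleftrightarrow> r \<in> cut_set \<alpha>"
  by (auto simp: cut_le_iff emb.rep_eq intro: cut_up)

lemma emb_le_iff: "emb r \<le> emb s \<longleftrightarrow> r \<le> s"
  by (simp add: le_emb_iff emb.rep_eq)

lemma emb_inject: "emb r = emb s \<longleftrightarrow> r = s"
  by (metis emb_le_iff order_antisym order_refl)

instantiation cut :: (distance_monoid) distance_monoid
begin

definition zero_cut :: "'a cut" where
  "zero_cut = emb 0"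

definition plus_cut :: "'a cut \<Rightarrow> 'a cut \<Rightarrow> 'a cut" where
  "plus_cut \<alpha> \<beta> = Inf {emb (r + s) | r s. \<alpha> \<le> emb r \<and> \<beta> \<le> emb s}"

lemma cut_set_plus:
  "cut_set (\<alpha> + \<beta>) = {x. \<exists>r\<in>cut_set \<alpha>. \<exists>s\<in>cut_set \<beta>. r + s \<le> x}" for \<alpha> \<beta> :: "'a cut"
proof -
  have "m + m \<le> x" if "\<forall>r. r \<le> x" for m x :: 'a
    using that by blast
  then have "{m. \<forall>r. r \<le> m} \<subseteq> {x. \<exists>r\<in>cut_set \<alpha>. \<exists>s\<in>cut_set \<beta>. r + s \<le> x}"
    using cut_max by blast
  moreover have "\<Union> (cut_set ` {emb (r + s) | r s. \<alpha> \<le> emb r \<and> \<beta> \<le> emb s}) =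
      {x. \<exists>r\<in>cut_set \<alpha>. \<exists>s\<in>cut_set \<beta>. r + s \<le> x}"
    unfolding le_emb_iff by (fastforce simp: emb.rep_eq)
  ultimately show ?thesis
    unfolding plus_cut_def Inf_cut.rep_eq by blast
qed

instance
proof
  have le: "r + s \<le> x" if "r \<le> r'" "s \<le> s'" "r' + s' \<le> x" for r s r' s' x :: 'a
    using add_mono_dist[OF that(1,2)] that(3) by (rule order_trans)
  fix \<alpha> \<beta> \<gamma> \<delta> :: "'a cut"
  have comm': "cut_set (\<alpha> + \<beta>) \<subseteq> cut_set (\<beta> + \<alpha>)" for \<alpha> \<beta> :: "'a cut"
    unfolding cut_set_plus by (auto, subst (asm) add.commute, blast)
  have comm: "\<alpha> + \<beta> = \<beta> + \<alpha>" for \<alpha> \<beta> :: "'a cut"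
    using comm'[of \<alpha> \<beta>] comm'[of \<beta> \<alpha>] by (simp add: cut_set_inject[symmetric])
  have rot: "cut_set (\<alpha> + \<beta> + \<gamma>) \<subseteq> cut_set (\<beta> + \<gamma> + \<alpha>)" for \<alpha> \<beta> \<gamma> :: "'a cut"
  proof
    fix x assume "x \<in> cut_set (\<alpha> + \<beta> + \<gamma>)"
    then obtain p r s t where *: "r \<in> cut_set \<alpha>" "s \<in> cut_set \<beta>" "t \<in> cut_set \<gamma>" "r + s \<le> p" "p + t \<le> x"
      unfolding cut_set_plus by blast
    have "s + t \<in> cut_set (\<beta> + \<gamma>)"
      unfolding cut_set_plus using * by blast
    moreover have "s + t + r \<le> x"
      using le[OF *(4) order_refl *(5)] by (metis add.assoc add.commute)
    ultimately show "x \<in> cut_set (\<beta> + \<gamma> + \<alpha>)"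
      unfolding cut_set_plus[of "\<beta> + \<gamma>"] using * by blast
  qed
  have "cut_set (\<alpha> + \<beta> + \<gamma>) = cut_set (\<beta> + \<gamma> + \<alpha>)"
    using rot[of \<alpha> \<beta> \<gamma>] rot[of \<beta> \<gamma> \<alpha>] rot[of \<gamma> \<alpha> \<beta>] by blast
  then show "\<alpha> + \<beta> + \<gamma> = \<alpha> + (\<beta> + \<gamma>)"
    by (simp add: cut_set_inject comm[of \<alpha> "\<beta> + \<gamma>"])
  show "\<alpha> + \<beta> = \<beta> + \<alpha>" by (rule comm)
  show "0 + \<alpha> = \<alpha>"
  proof -
    have "x \<in> cut_set (0 + \<alpha>) \<longleftrightarrow> x \<in> cut_set \<alpha>" for x
    proof
      assume "x \<in> cut_set (0 + \<alpha>)"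
      then obtain r s where "s \<in> cut_set \<alpha>" "r + s \<le> x"
        unfolding cut_set_plus by blast
      moreover have "s \<le> r + s"
        using le_add_dist[of s r] by (simp add: add.commute)
      ultimately show "x \<in> cut_set \<alpha>"
        using cut_up order_trans by blast
    next
      assume "x \<in> cut_set \<alpha>"
      moreover have "0 \<in> cut_set (0 :: 'a cut)" "0 + x \<le> x"
        by (simp_all add: zero_cut_def emb.rep_eq)
      ultimately show "x \<in> cut_set (0 + \<alpha>)"
        unfolding cut_set_plus by blast
    qed
    then show ?thesis
      by (simp add: cut_set_inject[symmetric] set_eq_iff)
  qed
  show "\<alpha> \<le> \<alpha> + \<beta>"
    unfolding cut_le_iff cut_set_plus using cut_up order_trans[OF le_add_dist] by blast
  show "\<alpha> + \<gamma> \<le> \<beta> + \<delta>" if "\<alpha> \<le> \<beta>" "\<gamma> \<le> \<delta>"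
    using that unfolding cut_le_iff cut_set_plus by blast
qed

end


section \<open>First-order logic over the language \<open>{d(x,y) \<le> s : s \<in> R}\<close>\<close>

text \<open>\<open>DLe x y s\<close> is the atomic formula \<open>d(x,y) \<le> s\<close>, a binary relation symbol for each \<open>s\<close>,
  applied to the variables \<open>x\<close> and \<open>y\<close>.  The logical constant \<open>Bot\<close> provides the
  quantifier-free sentences.\<close>

datatype 'r fm =
    Bot
  | Eq nat nat
  | DLe nat nat 'r
  | Imp "'r fm" "'r fm"
  | Forall nat "'r fm"

abbreviation Neg :: "'r fm \<Rightarrow> 'r fm" where
  "Neg \<phi> \<equiv> Imp \<phi> Bot"

abbreviation Top :: "'r fm" where
  "Top \<equiv> Neg Bot"

abbreviation Conj :: "'r fm \<Rightarrow> 'r fm \<Rightarrow> 'r fm" where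
  "Conj \<phi> \<psi> \<equiv> Neg (Imp \<phi> (Neg \<psi>))"

abbreviation Iff :: "'r fm \<Rightarrow> 'r fm \<Rightarrow> 'r fm" where
  "Iff \<phi> \<psi> \<equiv> Conj (Imp \<phi> \<psi>) (Imp \<psi> \<phi>)"

abbreviation Exists :: "nat \<Rightarrow> 'r fm \<Rightarrow> 'r fm" where
  "Exists x \<phi> \<equiv> Neg (Forall x (Neg \<phi>))"

definition BigConj :: "'r fm list \<Rightarrow> 'r fm" where
  "BigConj \<phi>s = foldr Conj \<phi>s Top"

definition ForallList :: "nat list \<Rightarrow> 'r fm \<Rightarrow> 'r fm" where
  "ForallList xs \<phi> = foldr Forall xs \<phi>"

primrec fv :: "'r fm \<Rightarrow> nat set" where
  "fv Bot = {}"
| "fv (Eq x y) = {x, y}"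
| "fv (DLe x y s) = {x, y}"
| "fv (Imp \<phi> \<psi>) = fv \<phi> \<union> fv \<psi>"
| "fv (Forall x \<phi>) = fv \<phi> - {x}"

primrec qfree :: "'r fm \<Rightarrow> bool" where
  "qfree Bot \<longleftrightarrow> True"
| "qfree (Eq x y) \<longleftrightarrow> True"
| "qfree (DLe x y s) \<longleftrightarrow> True"
| "qfree (Imp \<phi> \<psi>) \<longleftrightarrow> qfree \<phi> \<and> qfree \<psi>"
| "qfree (Forall x \<phi>) \<longleftrightarrow> False"

definition sentence :: "'r fm \<Rightarrow> bool" where
  "sentence \<phi> \<longleftrightarrow> fv \<phi> = {}"

definition univ_closure :: "'r fm \<Rightarrow> 'r fm" where
  "univ_closure \<phi> = ForallList (sorted_list_of_set (fv \<phi>)) \<phi>"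

text \<open>\<open>rel M s\<close> is the interpretation of \<open>d(\<cdot>,\<cdot>) \<le> s\<close>, an arbitrary binary relation; only its
  values on the carrier matter.\<close>

datatype ('r, 'm) lstruct = Struct (carrier: "'m set") (rel: "'r \<Rightarrow> 'm \<Rightarrow> 'm \<Rightarrow> bool")

primrec sat :: "('r, 'm) lstruct \<Rightarrow> (nat \<Rightarrow> 'm) \<Rightarrow> 'r fm \<Rightarrow> bool" where
  "sat M e Bot \<longleftrightarrow> False"
| "sat M e (Eq x y) \<longleftrightarrow> e x = e y"
| "sat M e (DLe x y s) \<longleftrightarrow> rel M s (e x) (e y)"
| "sat M e (Imp \<phi> \<psi>) \<longleftrightarrow> (sat M e \<phi> \<longrightarrow> sat M e \<psi>)"
| "sat M e (Forall x \<phi>) \<longleftrightarrow> (\<forall>a\<in>carrier M. sat M (e(x := a)) \<phi>)"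

definition holds :: "('r, 'm) lstruct \<Rightarrow> 'r fm \<Rightarrow> bool" where
  "holds M \<phi> \<longleftrightarrow> (\<forall>e. range e \<subseteq> carrier M \<longrightarrow> sat M e \<phi>)"

definition model_of :: "('r, 'm) lstruct \<Rightarrow> 'r fm set \<Rightarrow> bool" where
  "model_of M T \<longleftrightarrow> carrier M \<noteq> {} \<and> (\<forall>\<phi>\<in>T. holds M \<phi>)"

definition Th :: "('r, 'm) lstruct \<Rightarrow> 'r fm set" where
  "Th M = {\<phi>. sentence \<phi> \<and> holds M \<phi>}"

text \<open>Intended for deductively closed \<open>T\<close>, such as \<open>Th M\<close>: then membership in \<open>T\<close> is the same
  as being a consequence of \<open>T\<close>.\<close>

definition eliminates_quantifiers :: "'r fm set \<Rightarrow> bool" where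
  "eliminates_quantifiers T \<longleftrightarrow>
     (\<forall>\<phi>. \<exists>\<psi>. qfree \<psi> \<and> fv \<psi> \<subseteq> fv \<phi> \<and> univ_closure (Iff \<phi> \<psi>) \<in> T)"


section \<open>The Fraisse limit of the finite metric spaces\<close>

definition embedding :: "('r, 'a) lstruct \<Rightarrow> ('r, 'b) lstruct \<Rightarrow> ('a \<Rightarrow> 'b) \<Rightarrow> bool" where
  "embedding S M f \<longleftrightarrow> f ` carrier S \<subseteq> carrier M \<and> inj_on f (carrier S) \<and>
     (\<forall>s. \<forall>x\<in>carrier S. \<forall>y\<in>carrier S. rel M s (f x) (f y) \<longleftrightarrow> rel S s x y)"

definition automorphism :: "('r, 'a) lstruct \<Rightarrow> ('a \<Rightarrow> 'a) \<Rightarrow> bool" where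
  "automorphism M g \<longleftrightarrow> embedding M M g \<and> g ` carrier M = carrier M"

definition ultrahomogeneous :: "('r, 'a) lstruct \<Rightarrow> bool" where
  "ultrahomogeneous M \<longleftrightarrow>
     (\<forall>A f. finite A \<longrightarrow> A \<subseteq> carrier M \<longrightarrow> embedding (Struct A (rel M)) M f \<longrightarrow>
        (\<exists>g. automorphism M g \<and> (\<forall>x\<in>A. g x = f x)))"

text \<open>The language is relational, so finitely generated substructures are the finite ones.  Up to
  isomorphism they have carriers consisting of natural numbers, so a class of finite structures
  is represented by its members with such carriers.\<close>

definition age :: "('r, 'a) lstruct \<Rightarrow> ('r, nat) lstruct set" where
  "age M = {S. finite (carrier S) \<and> (\<exists>f. embedding S M f)}"

definition fraisse_limit :: "('r, nat) lstruct set \<Rightarrow> ('r, 'a) lstruct \<Rightarrow> bool" where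
  "fraisse_limit K M \<longleftrightarrow> countable (carrier M) \<and> age M = K \<and> ultrahomogeneous M"

definition finite_metric_structs :: "('r::distance_monoid, nat) lstruct set" where
  "finite_metric_structs = {S. finite (carrier S) \<and>
     (\<exists>d. metric_on (carrier S) d \<and>
        (\<forall>s. \<forall>x\<in>carrier S. \<forall>y\<in>carrier S. rel S s x y \<longleftrightarrow> d x y \<le> s))}"

definition is_Urysohn :: "('r::distance_monoid, 'u) lstruct \<Rightarrow> bool" where
  "is_Urysohn U \<longleftrightarrow> fraisse_limit finite_metric_structs U"


section \<open>The axioms\<close>

definition T_MS :: "'r::distance_monoid fm set" where
  "T_MS =
     {Forall 0 (Forall 1 (Iff (DLe 0 1 0) (Eq 0 1)))} \<union>
     {Forall 0 (Forall 1 (Iff (DLe 0 1 s) (DLe 1 0 s))) | s. True} \<union>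
     {Forall 0 (Forall 1 (Forall 2 (Imp (Conj (DLe 0 1 r) (DLe 1 2 s)) (DLe 0 2 t)))) | r s t.
        \<not> (\<exists>x. t < x \<and> x \<le> r + s)} \<union>
     {Forall 0 (Forall 1 (DLe 0 1 m)) | m. \<forall>r. r \<le> m}"

declare [[typedef_overloaded]]

text \<open>\<open>Zero\<close> is the set \<open>{0}\<close> and \<open>Ioc r s\<close> is the interval \<open>(r,s]\<close> of cuts.  A valid \<open>Ioc r s\<close> is
  determined by the interval it denotes.\<close>

datatype 'r interval = Zero | Ioc 'r "'r cut"

primrec valid_interval :: "'r::distance_monoid interval \<Rightarrow> bool" where
  "valid_interval Zero \<longleftrightarrow> True"
| "valid_interval (Ioc r s) \<longleftrightarrow> s \<in> range emb \<union> {top} \<and> emb r < s"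

primrec interval_set :: "'r::distance_monoid interval \<Rightarrow> 'r cut set" where
  "interval_set Zero = {0}"
| "interval_set (Ioc r s) = {emb r<..s}"

primrec DIn :: "nat \<Rightarrow> nat \<Rightarrow> 'r::distance_monoid interval \<Rightarrow> 'r fm" where
  "DIn x y Zero = Eq x y"
| "DIn x y (Ioc r s) =
     (if s \<in> range emb then Conj (Neg (DLe x y r)) (DLe x y (inv emb s)) else Neg (DLe x y r))"

text \<open>A finite space of cuts is given with an enumeration of its points, that is on \<open>{..<n}\<close>; the
  point \<open>z\<close> added by a one-point extension is \<open>n\<close>.\<close>

definition one_point_ext ::
  "nat \<Rightarrow> (nat \<Rightarrow> nat \<Rightarrow> 'r::distance_monoid cut) \<Rightarrow> (nat \<Rightarrow> 'r cut) \<Rightarrow> nat \<Rightarrow> nat \<Rightarrow> 'r cut" where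
  "one_point_ext n d f i j =
     (if i < n then (if j < n then d i j else f i) else (if j < n then f j else 0))"

definition approximation ::
  "nat \<Rightarrow> (nat \<Rightarrow> nat \<Rightarrow> 'r::distance_monoid cut) \<Rightarrow> (nat \<Rightarrow> nat \<Rightarrow> 'r interval) \<Rightarrow> bool" where
  "approximation m d \<Phi> \<longleftrightarrow>
     (\<forall>i<m. \<forall>j<m. \<Phi> i j = \<Phi> j i \<and> valid_interval (\<Phi> i j) \<and> d i j \<in> interval_set (\<Phi> i j))"

definition refines ::
  "nat \<Rightarrow> (nat \<Rightarrow> nat \<Rightarrow> 'r::distance_monoid interval) \<Rightarrow> (nat \<Rightarrow> nat \<Rightarrow> 'r interval) \<Rightarrow> bool" where
  "refines m \<Phi> \<Psi> \<longleftrightarrow> (\<forall>i<m. \<forall>j<m. interval_set (\<Phi> i j) \<subseteq> interval_set (\<Psi> i j))"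

datatype 'r scheme = Scheme
  (size_of: nat) (dist_of: "nat \<Rightarrow> nat \<Rightarrow> 'r cut") (ext_of: "nat \<Rightarrow> 'r cut")
  (appr_of: "nat \<Rightarrow> nat \<Rightarrow> 'r interval")

abbreviation ext_dist :: "'r::distance_monoid scheme \<Rightarrow> nat \<Rightarrow> nat \<Rightarrow> 'r cut" where
  "ext_dist E \<equiv> one_point_ext (size_of E) (dist_of E) (ext_of E)"

definition extension_scheme :: "'r::distance_monoid scheme \<Rightarrow> bool" where
  "extension_scheme E \<longleftrightarrow>
     metric_on {..<size_of E} (dist_of E) \<and>
     (\<forall>i<size_of E. 0 < ext_of E i) \<and>
     (\<forall>i<size_of E. \<forall>j<size_of E. triangle (dist_of E i j) (ext_of E i) (ext_of E j)) \<and>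
     approximation (Suc (size_of E)) (ext_dist E) (appr_of E)"

definition ext_axiom :: "nat \<Rightarrow> (nat \<Rightarrow> nat \<Rightarrow> 'r::distance_monoid interval) \<Rightarrow> 'r fm" where
  "ext_axiom n \<Phi> = ForallList [0..<n]
     (Imp (BigConj [DIn i j (\<Phi> i j). i \<leftarrow> [0..<n], j \<leftarrow> [0..<n]])
          (Exists n (BigConj [DIn i n (\<Phi> i n). i \<leftarrow> [0..<n]])))"

text \<open>The axioms depend on a choice of an approximation \<open>\<Phi>\<close> for each extension scheme.\<close>

definition admissible_choice ::
  "('r::distance_monoid, 'u) lstruct \<Rightarrow> ('r scheme \<Rightarrow> nat \<Rightarrow> nat \<Rightarrow> 'r interval) \<Rightarrow> bool" where
  "admissible_choice U c \<longleftrightarrow> (\<forall>E. extension_scheme E \<longrightarrow>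
     approximation (Suc (size_of E)) (ext_dist E) (c E) \<and>
     refines (Suc (size_of E)) (c E) (appr_of E) \<and>
     holds U (ext_axiom (size_of E) (c E)))"

definition T_ax :: "('r::distance_monoid scheme \<Rightarrow> nat \<Rightarrow> nat \<Rightarrow> 'r interval) \<Rightarrow> 'r fm set" where
  "T_ax c = T_MS \<union> {ext_axiom (size_of E) (c E) | E. extension_scheme E}"

end

theory Submission
  imports Defs "HOL-Library.Diagonal_Subsequence"
begin

text \<open>A model \<open>M\<close> of \<open>T_MS\<close> is a metric space over the cuts, \<open>d(x,y)\<close> being the cut of all \<open>s\<close> with
  \<open>d(x,y) \<le> s\<close>.  Replacing each distance of a finite subspace by a slightly larger element of \<open>R\<close>
  and passing to shortest paths gives an \<open>R\<close>-metric with the same relations \<open>d(x,y) \<le> s\<close> for any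
  finite set \<open>S\<close> of values \<open>s\<close>; so finite tuples of \<open>M\<close> agree on \<open>S\<close> with tuples of \<open>U\<close>.  A suitable
  choice of \<open>\<Phi>\<close> exists since the realizability of \<open>\<Psi>(\<cdot>,z)\<close> in \<open>U\<close> is expressed by a quantifier-free
  formula, hence determined by finitely many \<open>s\<close>.

  It remains to see that every equivalence of \<open>\<exists>x \<theta>\<close> with \<open>\<psi>\<close> (both \<open>\<theta>\<close> and \<open>\<psi>\<close> quantifier-free) valid
  in \<open>U\<close> is valid in \<open>M\<close>.  From \<open>\<exists>x \<theta>\<close> to \<open>\<psi>\<close>, copy a witness to \<open>U\<close>.  Conversely, if a tuple of \<open>M\<close>
  satisfies \<open>\<psi>\<close>, take copies in \<open>U\<close> agreeing with it on larger and larger finite sets that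
  exhaust \<open>R\<close>, and a witness for each copy.  A diagonal subsequence of the distances to the
  witnesses converges to a one-point extension over the cuts, which the extension axioms realize
  in \<open>M\<close> up to agreement on the values occurring in \<open>\<theta>\<close>.\<close>

section \<open>Cuts\<close>

lemma zero_le_dist: "(0::'a::distance_monoid) \<le> r"
  using le_add_dist[of 0 r] by simp

lemma le_add_dist2: "(s::'a::distance_monoid) \<le> r + s"
  using le_add_dist[of s r] by (simp add: add.commute)

lemma le_zero_dist: "(r::'a::distance_monoid) \<le> 0 \<longleftrightarrow> r = 0"
  using zero_le_dist[of r] by auto

lemma emb_zero: "emb 0 = 0"
  by (simp add: zero_cut_def)

lemma le_plus_cut_iff:
  "\<alpha> \<le> \<beta> + \<gamma> \<longleftrightarrow> (\<forall>r s. \<beta> \<le> emb r \<longrightarrow> \<gamma> \<le> emb s \<longrightarrow> \<alpha> \<le> emb (r + s))"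
  unfolding cut_le_iff[of \<alpha>] cut_set_plus le_emb_iff using cut_up by blast

lemma le_plus_cutD: "\<alpha> \<le> \<beta> + \<gamma> \<Longrightarrow> \<beta> \<le> emb r \<Longrightarrow> \<gamma> \<le> emb s \<Longrightarrow> \<alpha> \<le> emb (r + s)"
  unfolding le_plus_cut_iff by blast

text \<open>The set of all \<open>s\<close> with \<open>P s\<close> is itself a cut. Cuts arise in
  this way from the relations of a structure and as limits of sequences of cuts.\<close>

lemma cut_eq_of_levels:
  assumes "\<And>r s. P r \<Longrightarrow> r \<le> s \<Longrightarrow> P s" and "\<And>m. (\<And>r. r \<le> m) \<Longrightarrow> P m"
  shows "\<exists>\<alpha>. \<forall>s. \<alpha> \<le> emb s \<longleftrightarrow> P s"
proof -
  have "cut_set (Cut {s. P s}) = {s. P s}"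
    by (rule Cut_inverse) (use assms in blast)
  then have "\<forall>s. Cut {s. P s} \<le> emb s \<longleftrightarrow> P s"
    by (simp add: le_emb_iff)
  then show ?thesis by blast
qed

text \<open>A quantifier-free formula sees a distance only through finitely many such comparisons.
  Convergence of cuts means eventual agreement on each single element.\<close>

definition agree_on :: "'r::distance_monoid set \<Rightarrow> 'r cut \<Rightarrow> 'r cut \<Rightarrow> bool" where
  "agree_on S \<alpha> \<beta> \<longleftrightarrow> (\<forall>s\<in>S. \<alpha> \<le> emb s \<longleftrightarrow> \<beta> \<le> emb s)"

lemma agree_on_refl [simp]: "agree_on S \<alpha> \<alpha>"
  by (simp add: agree_on_def)

lemma agree_on_sym: "agree_on S \<alpha> \<beta> \<Longrightarrow> agree_on S \<beta> \<alpha>"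
  by (simp add: agree_on_def)

lemma agree_on_trans: "agree_on S \<alpha> \<beta> \<Longrightarrow> agree_on S \<beta> \<gamma> \<Longrightarrow> agree_on S \<alpha> \<gamma>"
  by (simp add: agree_on_def)

lemma agree_on_mono: "agree_on S \<alpha> \<beta> \<Longrightarrow> T \<subseteq> S \<Longrightarrow> agree_on T \<alpha> \<beta>"
  unfolding agree_on_def by blast

lemma agree_on_zero: "agree_on S \<alpha> \<beta> \<Longrightarrow> 0 \<in> S \<Longrightarrow> \<alpha> = 0 \<longleftrightarrow> \<beta> = 0"
  unfolding agree_on_def using le_zero_dist emb_zero by metis

text \<open>If some element of \<open>S\<close> bounds \<alpha>, the least such element works.
  Otherwise any element of the cut does, or, if the cut is empty, an element above all of
  \<open>S\<close>; this exists because there is then no maximum. The empty cut has no upper bound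
  among the \<open>emb r\<close>, hence the exception in the second conjunct.\<close>

lemma ex_agreeing_element:
  assumes "finite S"
  shows "\<exists>r. agree_on S (emb r) \<alpha> \<and> (cut_set \<alpha> \<noteq> {} \<longrightarrow> \<alpha> \<le> emb r)"
proof -
  consider (bounded) "\<exists>s\<in>S. \<alpha> \<le> emb s" | (nonempty) r where "\<alpha> \<le> emb r" "\<not> (\<exists>s\<in>S. \<alpha> \<le> emb s)"
    | (empty) "cut_set \<alpha> = {}"
    unfolding le_emb_iff by blast
  then show ?thesis
  proof cases
    case bounded
    define r where "r = Min {s\<in>S. \<alpha> \<le> emb s}"
    have fin: "finite {s\<in>S. \<alpha> \<le> emb s}" using assms by simp
    have "r \<in> {s\<in>S. \<alpha> \<le> emb s}"
      unfolding r_def by (rule Min_in[OF fin]) (use bounded in blast)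
    moreover have "r \<le> s" if "s \<in> S" "\<alpha> \<le> emb s" for s
      unfolding r_def by (rule Min_le[OF fin]) (use that in blast)
    ultimately show ?thesis
      unfolding agree_on_def emb_le_iff by (auto intro!: exI[of _ r] simp: le_emb_iff intro: cut_up)
  next
    case nonempty
    then show ?thesis
      unfolding agree_on_def by (meson order_trans)
  next
    case empty
    have "\<exists>r. \<forall>s\<in>S. s < r"
    proof (cases "S = {}")
      case False
      obtain r where "\<not> r \<le> Max S"
        using empty cut_max[of "Max S" \<alpha>] by blast
      then have "s < r" if "s \<in> S" for s
        using Max_ge[OF assms that] by auto
      then show ?thesis by blast
    qed simp
    then show ?thesis
      using empty unfolding agree_on_def emb_le_iff unfolding le_emb_iff by (auto simp: not_le)
  qed
qed

section \<open>Approximation of finite metric spaces of cuts\<close>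

lemma metric_onD:
  assumes "metric_on A d"
  shows "x \<in> A \<Longrightarrow> y \<in> A \<Longrightarrow> d x y = 0 \<longleftrightarrow> x = y"
    and "x \<in> A \<Longrightarrow> d x x = 0"
    and "x \<in> A \<Longrightarrow> y \<in> A \<Longrightarrow> d x y = d y x"
    and "x \<in> A \<Longrightarrow> y \<in> A \<Longrightarrow> z \<in> A \<Longrightarrow> d x z \<le> d x y + d y z"
  using assms unfolding metric_on_def by blast+

lemma metric_on_triangle:
  assumes "metric_on A d" "x \<in> A" "y \<in> A" "z \<in> A"
  shows "triangle (d x y) (d x z) (d y z)"
  unfolding triangle_def using metric_onD(3,4)[OF assms(1)] assms(2-) by metis

lemma metric_on_subset: "metric_on A d \<Longrightarrow> B \<subseteq> A \<Longrightarrow> metric_on B d"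
  unfolding metric_on_def by blast

lemma metric_on_inj_image:
  "metric_on B d \<Longrightarrow> inj_on f A \<Longrightarrow> f ` A \<subseteq> B \<Longrightarrow> metric_on A (\<lambda>x y. d (f x) (f y))"
  unfolding metric_on_def by (simp add: image_subset_iff inj_on_eq_iff)

section \<open>Weights of paths and removal of cycles\<close>

fun path_weight :: "('a \<Rightarrow> 'a \<Rightarrow> 'r::distance_monoid) \<Rightarrow> 'a list \<Rightarrow> 'r" where
  "path_weight w (x # y # p) = w x y + path_weight w (y # p)"
| "path_weight w _ = 0"

lemma path_weight_append:
  "path_weight w (p @ x # q) = path_weight w (p @ [x]) + path_weight w (x # q)"
  by (induction w p rule: path_weight.induct) (auto simp: add.assoc neq_Nil_conv)

lemma path_weight_rev:
  assumes "\<And>x y. w x y = w y x"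
  shows "path_weight w (rev p) = path_weight w p"
proof (induction p rule: induct_list012)
  case (3 x y p)
  have "path_weight w (rev (x # y # p)) = path_weight w (rev (y # p)) + w y x"
    using path_weight_append[of w "rev p" y "[x]"] by simp
  then show ?case
    using 3(2) assms[of y x] by (simp add: add.commute)
qed auto

definition paths :: "'a set \<Rightarrow> 'a \<Rightarrow> 'a \<Rightarrow> 'a list set" where
  "paths A x y = {p. p \<noteq> [] \<and> hd p = x \<and> last p = y \<and> set p \<subseteq> A}"

text \<open>Cutting out a cycle does not increase the weight, since summands are at most the sum. A
  minimum over all paths thus reduces to the finitely many distinct ones.\<close>

lemma ex_distinct_path:
  assumes "p \<in> paths A x y"
  shows "\<exists>q\<in>paths A x y. distinct q \<and> path_weight w q \<le> path_weight w p"
  using assms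
proof (induction "length p" arbitrary: p rule: less_induct)
  case less
  show ?case
  proof (cases "distinct p")
    case False
    then obtain a b c z where p: "p = a @ [z] @ b @ [z] @ c"
      using not_distinct_decomp by blast
    let ?q = "a @ z # c"
    have "?q \<in> paths A x y"
      using less.prems unfolding p paths_def by (cases a; cases c) auto
    moreover have "path_weight w ?q \<le> path_weight w p"
    proof -
      have "path_weight w (z # c) \<le> path_weight w (z # b @ z # c)"
        using path_weight_append[of w "z # b" z c] le_add_dist2 by simp
      then show ?thesis
        unfolding p using path_weight_append[of w a z c] path_weight_append[of w a z "b @ z # c"]
        by (simp add: add_mono_dist)
    qed
    ultimately show ?thesis
      using less.hyps[of ?q] unfolding p by (auto intro: order_trans)
  qed (use less in blast)
qed

text \<open>Distances are replaced by agreeing elements \<open>W (d x y)\<close>, and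
  \<open>d'\<close> is the shortest-path metric for these weights. The single edge gives
  \<open>d' x y \<le> W (d x y)\<close>. Conversely, all edges of a path of weight at most
  \<open>s \<in> S\<close> have weight at most \<open>s\<close>, and the triangle inequality for
  \<open>d\<close> bounds \<open>d x y\<close> by the weight of the path. Adding \<open>0\<close> to
  \<open>S\<close> keeps distinct points at nonzero distance.\<close>

lemma ex_approximating_metric:
  fixes d :: "'a \<Rightarrow> 'a \<Rightarrow> 'r::distance_monoid cut"
  assumes A: "finite A" "metric_on A d" and S: "finite S"
  shows "\<exists>d'. metric_on A d' \<and> (\<forall>x\<in>A. \<forall>y\<in>A. agree_on S (emb (d' x y)) (d x y))"
proof -
  obtain W where W: "\<And>\<alpha>. agree_on (insert 0 S) (emb (W \<alpha>)) \<alpha>"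
    and W': "\<And>\<alpha>. cut_set \<alpha> \<noteq> {} \<Longrightarrow> \<alpha> \<le> emb (W \<alpha>)"
    using ex_agreeing_element[of "insert 0 S"] S by (metis finite_insert)
  \<comment> \<open>The value 0 off \<open>A\<close> makes \<open>w\<close> symmetric everywhere, as
    \<open>path_weight_rev\<close> requires.\<close>
  define w where "w x y = (if x \<in> A \<and> y \<in> A then W (d x y) else 0)" for x y
  have w_sym: "w x y = w y x" for x y
    unfolding w_def using metric_onD(3)[OF A(2)] by auto
  define P where "P x y = path_weight w ` {p \<in> paths A x y. distinct p}" for x y
  define d' where "d' x y = Min (P x y)" for x y
  have fin: "finite (P x y)" for x y
  proof -
    have "{p \<in> paths A x y. distinct p} \<subseteq> {p. set p \<subseteq> A \<and> distinct p}"
      unfolding paths_def by blast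
    then show ?thesis
      unfolding P_def using finite_subset_distinct[OF A(1)] finite_subset by blast
  qed
  have d'_le: "d' x y \<le> path_weight w p" if p: "p \<in> paths A x y" for x y p
  proof -
    obtain q where "q \<in> paths A x y" "distinct q" "path_weight w q \<le> path_weight w p"
      using ex_distinct_path[OF p] by blast
    then have "path_weight w q \<in> P x y"
      unfolding P_def by blast
    then have "d' x y \<le> path_weight w q"
      unfolding d'_def by (rule Min_le[OF fin])
    with \<open>path_weight w q \<le> path_weight w p\<close> show ?thesis by (rule order_trans[rotated])
  qed
  have edge: "[x, y] \<in> paths A x y" if "x \<in> A" "y \<in> A" for x y
    using that by (simp add: paths_def)
  have d'_attained: "\<exists>p\<in>paths A x y. d' x y = path_weight w p" if xy: "x \<in> A" "y \<in> A" for x y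
  proof -
    have "P x y \<noteq> {}"
      unfolding P_def using ex_distinct_path[OF edge[OF xy]] by blast
    then have "d' x y \<in> P x y"
      unfolding d'_def by (rule Min_in[OF fin])
    then show ?thesis
      unfolding P_def by blast
  qed
  have upper: "d' x y \<le> W (d x y)" if "x \<in> A" "y \<in> A" for x y
    using d'_le[OF edge[OF that]] that by (simp add: w_def)
  \<comment> \<open>The bound \<open>s\<close> serves to exclude the empty cut: an edge of weight at
    most \<open>s\<close> has \<open>d x y \<le> emb s\<close> by agreement, so its cut is nonempty
    and its weight is a true upper bound of \<open>d x y\<close>.\<close>
  have path: "d (hd p) (last p) \<le> emb (path_weight w p)"
    if "s \<in> insert 0 S" "path_weight w p \<le> s" "set p \<subseteq> A" "p \<noteq> []" for p s
    using that(2-)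
  proof (induction p rule: induct_list012)
    case (3 x y p)
    have xy: "x \<in> A" "y \<in> A" "last (y # p) \<in> A"
      using 3(4) last_in_set[of "y # p"] by auto
    have "w x y \<le> s" "path_weight w (y # p) \<le> s"
      using 3(3) le_add_dist le_add_dist2 by (metis order_trans path_weight.simps(1))+
    then have "d x y \<le> emb s"
      using W[of "d x y"] that(1) xy unfolding agree_on_def w_def emb_le_iff by auto
    then have "d x y \<le> emb (w x y)"
      using W'[of "d x y"] xy unfolding w_def le_emb_iff by auto
    moreover have "d y (last (y # p)) \<le> emb (path_weight w (y # p))"
      using 3(2)[OF \<open>path_weight w (y # p) \<le> s\<close>] 3(4) by simp
    moreover have "d x (last (y # p)) \<le> d x y + d y (last (y # p))"
      using metric_onD(4)[OF A(2)] xy by blast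
    ultimately have "d x (last (y # p)) \<le> emb (w x y + path_weight w (y # p))"
      using le_plus_cutD by blast
    then show ?case by simp
  qed (use A(2) in \<open>auto simp: metric_onD emb_zero\<close>)
  have agree: "agree_on (insert 0 S) (emb (d' x y)) (d x y)" if xy: "x \<in> A" "y \<in> A" for x y
    unfolding agree_on_def
  proof
    fix s assume s: "s \<in> insert 0 S"
    show "emb (d' x y) \<le> emb s \<longleftrightarrow> d x y \<le> emb s"
    proof
      assume "emb (d' x y) \<le> emb s"
      moreover obtain p where p: "p \<in> paths A x y" "d' x y = path_weight w p"
        using d'_attained[OF xy] by blast
      ultimately show "d x y \<le> emb s"
        using path[OF s, of p] unfolding paths_def emb_le_iff
        by (metis (mono_tags, lifting) emb_le_iff mem_Collect_eq order_trans)
    next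
      assume "d x y \<le> emb s"
      then have "W (d x y) \<le> s"
        using W[of "d x y"] s unfolding agree_on_def emb_le_iff by blast
      then show "emb (d' x y) \<le> emb s"
        using upper[OF xy] unfolding emb_le_iff by simp
    qed
  qed
  have "metric_on A d'"
    unfolding metric_on_def
  proof (intro conjI ballI)
    fix x y assume xy: "x \<in> A" "y \<in> A"
    have "d' x y = 0 \<longleftrightarrow> d x y = 0"
      using agree_on_zero[OF agree[OF xy]] emb_inject[of "d' x y" 0] by (simp add: emb_zero)
    then show "d' x y = 0 \<longleftrightarrow> x = y"
      using metric_onD(1)[OF A(2) xy] by simp
    have le: "d' x y \<le> d' y x" if xy: "x \<in> A" "y \<in> A" for x y
    proof -
      obtain p where p: "p \<in> paths A y x" "d' y x = path_weight w p"
        using d'_attained[OF xy(2,1)] by blast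
      then have "rev p \<in> paths A x y"
        unfolding paths_def by (auto simp: hd_rev last_rev)
      then show ?thesis
        using d'_le[of "rev p" x y] path_weight_rev[of w p, OF w_sym] p(2) by simp
    qed
    show "d' x y = d' y x"
      using le[OF xy] le[OF xy(2,1)] by simp
  next
    fix x y z assume xyz: "x \<in> A" "y \<in> A" "z \<in> A"
    obtain p where p: "p \<in> paths A x y" "d' x y = path_weight w p"
      using d'_attained[OF xyz(1,2)] by blast
    obtain q where q: "q \<in> paths A y z" "d' y z = path_weight w q"
      using d'_attained[OF xyz(2,3)] by blast
    obtain p' where p': "p = p' @ [y]"
      using p(1) unfolding paths_def by (cases p rule: rev_cases) auto
    obtain q' where q': "q = y # q'"
      using q(1) unfolding paths_def by (cases q) auto
    have "p' @ y # q' \<in> paths A x z"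
      using p(1) q(1) unfolding p' q' paths_def by (cases p') auto
    from d'_le[OF this] show "d' x z \<le> d' x y + d' y z"
      unfolding path_weight_append[of w p' y q'] p(2) q(2) p' q' .
  qed
  moreover have "\<forall>x\<in>A. \<forall>y\<in>A. agree_on S (emb (d' x y)) (d x y)"
    by (intro ballI agree_on_mono[OF agree]) auto
  ultimately show ?thesis by (intro exI conjI)
qed

section \<open>Structures with a metric of cuts\<close>

definition cut_metric :: "('r::distance_monoid, 'm) lstruct \<Rightarrow> ('m \<Rightarrow> 'm \<Rightarrow> 'r cut) \<Rightarrow> bool" where
  "cut_metric M D \<longleftrightarrow> metric_on (carrier M) D \<and>
     (\<forall>s. \<forall>x\<in>carrier M. \<forall>y\<in>carrier M. rel M s x y \<longleftrightarrow> D x y \<le> emb s)"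

lemma cut_metricD:
  assumes "cut_metric M D"
  shows "metric_on (carrier M) D"
    and "x \<in> carrier M \<Longrightarrow> y \<in> carrier M \<Longrightarrow> rel M s x y \<longleftrightarrow> D x y \<le> emb s"
  using assms unfolding cut_metric_def by blast+

section \<open>Formulas, their constants, and truth under a metric of cuts\<close>

primrec consts_of :: "'r fm \<Rightarrow> 'r set" where
  "consts_of Bot = {}"
| "consts_of (Eq x y) = {}"
| "consts_of (DLe x y s) = {s}"
| "consts_of (Imp \<phi> \<psi>) = consts_of \<phi> \<union> consts_of \<psi>"
| "consts_of (Forall x \<phi>) = consts_of \<phi>"

lemma finite_consts_of: "finite (consts_of \<phi>)"
  by (induction \<phi>) auto

lemma finite_fv: "finite (fv \<phi>)"
  by (induction \<phi>) auto

lemma sat_cong: "(\<And>v. v \<in> fv \<phi> \<Longrightarrow> e v = e' v) \<Longrightarrow> sat M e \<phi> \<longleftrightarrow> sat M e' \<phi>"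
proof (induction \<phi> arbitrary: e e')
  case (Imp \<phi> \<psi>)
  then show ?case by (metis UnCI fv.simps(4) sat.simps(4))
next
  case (Forall x \<phi>)
  have "sat M (e(x := a)) \<phi> \<longleftrightarrow> sat M (e'(x := a)) \<phi>" for a
    by (rule Forall.IH) (use Forall.prems in auto)
  then show ?case by simp
qed auto

lemma range_upd: "range e \<subseteq> A \<Longrightarrow> a \<in> A \<Longrightarrow> range (e(x := a)) \<subseteq> A"
  by auto

text \<open>\<open>holds\<close> already ranges over all environments in the carrier, so a leading
  universal quantifier changes nothing.\<close>

lemma holds_Forall: "holds M (Forall x \<phi>) \<longleftrightarrow> holds M \<phi>"
proof
  assume L: "holds M (Forall x \<phi>)"
  show "holds M \<phi>"
    unfolding holds_def
  proof (intro allI impI)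
    fix e :: "nat \<Rightarrow> 'b" assume e: "range e \<subseteq> carrier M"
    then have "sat M (e(x := e x)) \<phi>"
      using L unfolding holds_def sat.simps by (metis range_subsetD)
    then show "sat M e \<phi>" by simp
  qed
next
  assume "holds M \<phi>"
  then show "holds M (Forall x \<phi>)"
    unfolding holds_def sat.simps using range_upd by metis
qed

lemma holds_ForallList: "holds M (ForallList xs \<phi>) \<longleftrightarrow> holds M \<phi>"
  unfolding ForallList_def by (induction xs) (auto simp: holds_Forall)

lemma sat_BigConj: "sat M e (BigConj \<phi>s) \<longleftrightarrow> (\<forall>\<phi>\<in>set \<phi>s. sat M e \<phi>)"
  unfolding BigConj_def by (induction \<phi>s) auto

lemma fv_BigConj: "fv (BigConj \<phi>s) = (\<Union>\<phi>\<in>set \<phi>s. fv \<phi>)"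
  unfolding BigConj_def by (induction \<phi>s) auto

lemma fv_ForallList: "fv (ForallList xs \<phi>) = fv \<phi> - set xs"
  unfolding ForallList_def by (induction xs) auto

lemma fv_DIn: "fv (DIn x y I) = {x, y}"
  by (cases I) auto

text \<open>A \<open>DLe\<close> atom compares a distance with a constant of the formula, and an
  \<open>Eq\<close> atom asks whether a distance is 0; hence the set contains \<open>0\<close> and
  the constants. Without free variables the agreement hypothesis is vacuous.\<close>

lemma sat_qfree_agree:
  assumes M: "cut_metric M D" "range e \<subseteq> carrier M"
    and N: "cut_metric N D'" "range e' \<subseteq> carrier N"
    and "qfree \<phi>"
    and "\<And>v w. v \<in> fv \<phi> \<Longrightarrow> w \<in> fv \<phi> \<Longrightarrow> agree_on (insert 0 (consts_of \<phi>)) (D (e v) (e w)) (D' (e' v) (e' w))"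
  shows "sat M e \<phi> \<longleftrightarrow> sat N e' \<phi>"
  using assms(5-)
proof (induction \<phi>)
  have e: "e v \<in> carrier M" "e' v \<in> carrier N" for v
    using assms by auto
  {
    case (Eq x y)
    then have "D (e x) (e y) = 0 \<longleftrightarrow> D' (e' x) (e' y) = 0"
      by (intro agree_on_zero[of "{0}"]) auto
    then show ?case
      using metric_onD(1)[OF cut_metricD(1)] M(1) N(1) e by (metis sat.simps(2))
  next
    case (DLe x y s)
    have "agree_on {0, s} (D (e x) (e y)) (D' (e' x) (e' y))"
      using DLe(2)[of x y] by simp
    then show ?case
      using cut_metricD(2)[OF M(1) e(1) e(1)] cut_metricD(2)[OF N(1) e(2) e(2)]
      by (simp add: agree_on_def)
  next
    case (Imp \<phi> \<psi>)
    have "sat M e \<phi> \<longleftrightarrow> sat N e' \<phi>" "sat M e \<psi> \<longleftrightarrow> sat N e' \<psi>"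
      by (rule Imp.IH; use Imp.prems(1) in \<open>auto intro!: agree_on_mono[OF Imp.prems(2)]\<close>)+
    then show ?case by simp
  }
qed auto

lemma sat_DIn:
  assumes M: "cut_metric M D" and xy: "e x \<in> carrier M" "e y \<in> carrier M" and I: "valid_interval I"
  shows "sat M e (DIn x y I) \<longleftrightarrow> D (e x) (e y) \<in> interval_set I"
proof (cases I)
  case Zero
  then show ?thesis
    using metric_onD(1)[OF cut_metricD(1)[OF M] xy] by simp
next
  case (Ioc r s)
  show ?thesis
  proof (cases "s \<in> range emb")
    case True
    then have "emb (inv emb s) = s"
      by (rule f_inv_into_f)
    then show ?thesis
      unfolding Ioc using True cut_metricD(2)[OF M xy] by (simp add: not_le[symmetric])
  next
    case False
    then have "s = top"
      using I Ioc by simp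
    then show ?thesis
      unfolding Ioc using False cut_metricD(2)[OF M xy] by (simp add: not_le)
  qed
qed

lemma sat_Exists_DIn:
  assumes M: "cut_metric M D" and e: "range e \<subseteq> carrier M" and I: "\<And>i. i < n \<Longrightarrow> valid_interval (I i)"
  shows "sat M e (Exists n (BigConj [DIn i n (I i). i \<leftarrow> [0..<n]])) \<longleftrightarrow>
    (\<exists>y\<in>carrier M. \<forall>i<n. D (e i) y \<in> interval_set (I i))"
proof -
  have "sat M (e(n := y)) (DIn i n (I i)) \<longleftrightarrow> D (e i) y \<in> interval_set (I i)"
    if "i < n" "y \<in> carrier M" for i y
    using sat_DIn[OF M, of "e(n := y)" i n] I that e by (simp add: image_subset_iff)
  then have "sat M (e(n := y)) (BigConj [DIn i n (I i). i \<leftarrow> [0..<n]]) \<longleftrightarrow>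
      (\<forall>i<n. D (e i) y \<in> interval_set (I i))" if "y \<in> carrier M" for y
    using that by (auto simp: sat_BigConj)
  then show ?thesis by auto
qed

text \<open>The variables below \<open>n\<close> name the given points and the bound variable
  \<open>n\<close> names the new one; the other values of an environment do not matter.\<close>

lemma holds_ext_axiom:
  assumes M: "cut_metric M D" and \<Phi>: "\<And>i j. i \<le> n \<Longrightarrow> j \<le> n \<Longrightarrow> valid_interval (\<Phi> i j)"
  shows "holds M (ext_axiom n \<Phi>) \<longleftrightarrow>
    (\<forall>e. range e \<subseteq> carrier M \<longrightarrow> (\<forall>i<n. \<forall>j<n. D (e i) (e j) \<in> interval_set (\<Phi> i j)) \<longrightarrow>
      (\<exists>y\<in>carrier M. \<forall>i<n. D (e i) y \<in> interval_set (\<Phi> i n)))"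
proof -
  have "sat M e (BigConj [DIn i j (\<Phi> i j). i \<leftarrow> [0..<n], j \<leftarrow> [0..<n]]) \<longleftrightarrow>
      (\<forall>i<n. \<forall>j<n. D (e i) (e j) \<in> interval_set (\<Phi> i j))" if "range e \<subseteq> carrier M" for e
  proof -
    have "sat M e (DIn i j (\<Phi> i j)) \<longleftrightarrow> D (e i) (e j) \<in> interval_set (\<Phi> i j)" if "i < n" "j < n" for i j
      using sat_DIn[OF M] \<Phi> that \<open>range e \<subseteq> carrier M\<close> by (simp add: image_subset_iff)
    then show ?thesis
      by (auto simp: sat_BigConj)
  qed
  then show ?thesis
    unfolding ext_axiom_def holds_ForallList unfolding holds_def sat.simps(4)[of M _ "BigConj _"]
    using sat_Exists_DIn[OF M, of _ n "\<lambda>i. \<Phi> i n"] \<Phi> by simp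
qed

lemma sentence_ext_axiom: "sentence (ext_axiom n \<Phi>)"
  unfolding sentence_def ext_axiom_def by (auto simp: fv_ForallList fv_BigConj fv_DIn)

lemma sentence_T_MS: "\<phi> \<in> T_MS \<Longrightarrow> sentence \<phi>"
  unfolding T_MS_def sentence_def by auto

section \<open>The metric of cuts on a model of \<open>T_MS\<close>\<close>

lemma ex_env: "\<lbrakk>x \<in> A; y \<in> A; z \<in> A\<rbrakk> \<Longrightarrow> \<exists>e. range e \<subseteq> A \<and> e (0::nat) = x \<and> e 1 = y \<and> e 2 = z"
  by (rule exI[of _ "\<lambda>n. if n = 0 then x else if n = 1 then y else z"]) auto

text \<open>The levels \<open>s\<close> at which \<open>rel M s x y\<close> holds form a cut, and
  the triangle axioms for all \<open>r\<close>, \<open>s\<close> are the triangle inequality for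
  these cuts, in the form of \<open>le_plus_cut_iff\<close>.\<close>

lemma T_MS_cut_metric:
  fixes M :: "('r::distance_monoid, 'm) lstruct"
  assumes "\<forall>\<phi>\<in>T_MS. holds M \<phi>"
  shows "\<exists>D. cut_metric M D"
proof -
  have refl: "rel M 0 x y \<longleftrightarrow> x = y" if xy: "x \<in> carrier M" "y \<in> carrier M" for x y
  proof -
    have "holds M (Forall 0 (Forall 1 (Iff (DLe 0 1 0) (Eq 0 1))))"
      using assms unfolding T_MS_def by blast
    moreover obtain e where e: "range e \<subseteq> carrier M" "e (0::nat) = x" "e 1 = y"
      using ex_env[OF xy xy(1)] by blast
    ultimately have "sat M e (Iff (DLe 0 1 0) (Eq 0 1))"
      unfolding holds_Forall unfolding holds_def by blast
    then show ?thesis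
      using e by auto
  qed
  have sym: "rel M s x y \<Longrightarrow> rel M s y x" if xy: "x \<in> carrier M" "y \<in> carrier M" for x y s
  proof -
    have "holds M (Forall 0 (Forall 1 (Iff (DLe 0 1 s) (DLe 1 0 s))))"
      using assms unfolding T_MS_def by blast
    moreover obtain e where e: "range e \<subseteq> carrier M" "e (0::nat) = x" "e 1 = y"
      using ex_env[OF xy xy(1)] by blast
    ultimately have "sat M e (Iff (DLe 0 1 s) (DLe 1 0 s))"
      unfolding holds_Forall unfolding holds_def by blast
    then show "rel M s x y \<Longrightarrow> rel M s y x"
      using e by auto
  qed
  have tri: "rel M t x z" if "rel M r x y" "rel M s y z" "r + s \<le> t"
    and xyz: "x \<in> carrier M" "y \<in> carrier M" "z \<in> carrier M" for x y z r s t
  proof -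
    have "holds M (Forall 0 (Forall 1 (Forall 2 (Imp (Conj (DLe 0 1 r) (DLe 1 2 s)) (DLe 0 2 t)))))"
      using assms that(3) unfolding T_MS_def by fastforce
    then have "\<forall>e::nat \<Rightarrow> 'm. range e \<subseteq> carrier M \<longrightarrow> rel M r (e 0) (e 1) \<longrightarrow> rel M s (e 1) (e 2) \<longrightarrow> rel M t (e 0) (e 2)"
      unfolding holds_Forall unfolding holds_def by simp
    then show ?thesis
      using ex_env[OF xyz] that(1,2) by blast
  qed
  have max: "rel M m x y" if "\<And>r. r \<le> m" and xy: "x \<in> carrier M" "y \<in> carrier M" for x y m
  proof -
    have "holds M (Forall 0 (Forall 1 (DLe 0 1 m)))"
      using assms that(1) unfolding T_MS_def by blast
    then have "\<forall>e::nat \<Rightarrow> 'm. range e \<subseteq> carrier M \<longrightarrow> rel M m (e 0) (e 1)"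
      unfolding holds_Forall unfolding holds_def by simp
    then show ?thesis
      using ex_env[OF xy xy(1)] by blast
  qed
  \<comment> \<open>Upward closure is the triangle axiom for \<open>x\<close>, \<open>y\<close>,
    \<open>y\<close> with second distance at most 0. Outside the carrier every level is declared to
    hold, which gives distance 0 there.\<close>
  have "\<exists>\<alpha>. \<forall>s. \<alpha> \<le> emb s \<longleftrightarrow> (x \<in> carrier M \<and> y \<in> carrier M \<longrightarrow> rel M s x y)" for x y
    using tri[of _ x y 0 y] refl[of y y] max by (intro cut_eq_of_levels) auto
  then obtain D where D': "\<And>x y s. D x y \<le> emb s \<longleftrightarrow> (x \<in> carrier M \<and> y \<in> carrier M \<longrightarrow> rel M s x y)"
    by metis
  then have D: "D x y \<le> emb s \<longleftrightarrow> rel M s x y" if "x \<in> carrier M" "y \<in> carrier M" for x y s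
    using that by blast
  have "metric_on (carrier M) D"
    unfolding metric_on_def
  proof (intro conjI ballI)
    fix x y assume xy: "x \<in> carrier M" "y \<in> carrier M"
    show "D x y = 0 \<longleftrightarrow> x = y"
      using D[OF xy, of 0] refl[OF xy] le_zero_dist[of "D x y"] by (simp add: emb_zero)
    have "D x y \<le> emb s \<longleftrightarrow> D y x \<le> emb s" for s
      using D[OF xy, of s] D[OF xy(2,1), of s] sym xy by blast
    then show "D x y = D y x"
      unfolding le_emb_iff cut_set_inject[symmetric] by blast
  next
    fix x y z assume xyz: "x \<in> carrier M" "y \<in> carrier M" "z \<in> carrier M"
    then show "D x z \<le> D x y + D y z"
      unfolding le_plus_cut_iff using D tri by blast
  qed
  then show ?thesis
    using D unfolding cut_metric_def by blast
qed

section \<open>The Urysohn space\<close>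

text \<open>The age contains only structures on natural numbers, so \<open>A\<close> is first copied
  to \<open>{..<card A}\<close> and the metric found there is carried back.\<close>

lemma Urysohn_finite_subspace:
  assumes U: "is_Urysohn U" and A: "finite A" "A \<subseteq> carrier U"
  shows "\<exists>d. metric_on A d \<and> (\<forall>s. \<forall>x\<in>A. \<forall>y\<in>A. rel U s x y \<longleftrightarrow> d x y \<le> s)"
proof -
  obtain h where h: "bij_betw h A {..<card A}"
    using ex_bij_betw_finite_nat[OF A(1)] by (auto simp: atLeast0LessThan)
  let ?g = "inv_into A h"
  have g: "bij_betw ?g {..<card A} A"
    by (rule bij_betw_inv_into[OF h])
  define S where "S = Struct {..<card A} (\<lambda>s i j. rel U s (?g i) (?g j))"
  have "embedding S U ?g"
    using g A(2) unfolding embedding_def S_def bij_betw_def by auto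
  then have "S \<in> age U"
    unfolding age_def S_def by auto
  then have "S \<in> finite_metric_structs"
    using U unfolding is_Urysohn_def fraisse_limit_def by blast
  then obtain d where d: "metric_on {..<card A} d"
    "\<And>s i j. i < card A \<Longrightarrow> j < card A \<Longrightarrow> rel U s (?g i) (?g j) \<longleftrightarrow> d i j \<le> s"
    unfolding finite_metric_structs_def S_def by auto
  have h': "h x < card A" "?g (h x) = x" if "x \<in> A" for x
    using h that bij_betw_inv_into_left[OF h] by (auto simp: bij_betw_def)
  have "metric_on A (\<lambda>x y. d (h x) (h y))"
    using h by (intro metric_on_inj_image[OF d(1)]) (auto simp: bij_betw_def)
  moreover have "\<forall>s. \<forall>x\<in>A. \<forall>y\<in>A. rel U s x y \<longleftrightarrow> d (h x) (h y) \<le> s"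
    using d(2) h' by metis
  ultimately show ?thesis by (intro exI conjI)
qed

text \<open>The one-point metric space belongs to the age.\<close>

lemma Urysohn_nonempty: "is_Urysohn U \<Longrightarrow> carrier U \<noteq> {}"
proof -
  assume U: "is_Urysohn U"
  let ?S = "Struct {0::nat} (\<lambda>(s::'a) _ _. True)"
  have "metric_on {0::nat} (\<lambda>_ _. 0::'a)"
    unfolding metric_on_def by simp
  then have "?S \<in> finite_metric_structs"
    unfolding finite_metric_structs_def by (auto intro!: exI[of _ "\<lambda>_ _. 0"] simp: zero_le_dist)
  then have "?S \<in> age U"
    using U unfolding is_Urysohn_def fraisse_limit_def by blast
  then show ?thesis
    unfolding age_def embedding_def by auto
qed

text \<open>Each axiom speaks of at most three points, and these form a finite metric subspace with
  distances in \<open>'r\<close>.\<close>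

lemma Urysohn_T_MS:
  fixes U :: "('r::distance_monoid, 'u) lstruct"
  assumes U: "is_Urysohn U" and \<phi>: "\<phi> \<in> T_MS"
  shows "holds U \<phi>"
proof -
  let ?matrix = "\<lambda>\<psi>. \<psi> = Iff (DLe 0 1 0) (Eq 0 1) \<or> (\<exists>s. \<psi> = Iff (DLe 0 1 s) (DLe 1 0 s)) \<or>
      (\<exists>r s t. \<psi> = Imp (Conj (DLe 0 1 r) (DLe 1 2 s)) (DLe 0 2 t) \<and> \<not> (\<exists>x. t < x \<and> x \<le> r + s)) \<or>
      (\<exists>m. \<psi> = DLe 0 1 m \<and> (\<forall>r. r \<le> m))"
  have matrix: "sat U e \<psi>" if e: "range e \<subseteq> carrier U" and \<psi>: "?matrix \<psi>" for e \<psi>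
  proof -
    let ?A = "{e 0, e 1, e 2}"
    obtain d where d: "metric_on ?A d"
      and rel: "\<And>s x y. x \<in> ?A \<Longrightarrow> y \<in> ?A \<Longrightarrow> rel U s x y \<longleftrightarrow> d x y \<le> s"
      using Urysohn_finite_subspace[OF U, of ?A] e by (auto simp: image_subset_iff)
    have *: "d (e 0) (e 1) = 0 \<longleftrightarrow> e 0 = e 1" "d (e 0) (e 1) = d (e 1) (e 0)"
      "d (e 0) (e 2) \<le> d (e 0) (e 1) + d (e 1) (e 2)"
      using metric_onD[OF d] by auto
    \<comment> \<open>Otherwise the distance itself would be an \<open>x\<close> excluded by the
      side condition of the axiom.\<close>
    have "d (e 0) (e 2) \<le> t"
      if "d (e 0) (e 1) \<le> r" "d (e 1) (e 2) \<le> s" "\<not> (\<exists>x. t < x \<and> x \<le> r + s)" for r s t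
      using order_trans[OF *(3) add_mono_dist[OF that(1,2)]] that(3) by (meson not_le)
    with \<psi> *(1,2) show ?thesis
      by (elim disjE exE) (auto simp: rel le_zero_dist)
  qed
  obtain \<psi> where \<psi>: "?matrix \<psi>" "\<phi> = Forall 0 (Forall 1 \<psi>) \<or> \<phi> = Forall 0 (Forall 1 (Forall 2 \<psi>))"
    using \<phi> unfolding T_MS_def by blast
  have "holds U \<psi>"
    unfolding holds_def by (intro allI impI matrix \<psi>(1))
  then show ?thesis
    using \<psi>(2) by (elim disjE) (simp_all only: holds_Forall)
qed

text \<open>The distances of \<open>A\<close> are cuts, so \<open>A\<close> itself need not embed in
  \<open>U\<close>; the approximating metric has values in \<open>'r\<close>, which puts a copy of
  it in the age.\<close>

lemma Urysohn_realizes: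
  assumes U: "is_Urysohn U" "cut_metric U DU" and A: "finite A" "metric_on A d" and S: "finite S"
  shows "\<exists>h. h ` A \<subseteq> carrier U \<and> (\<forall>x\<in>A. \<forall>y\<in>A. agree_on S (DU (h x) (h y)) (d x y))"
proof -
  obtain d' where d': "metric_on A d'" "\<And>x y. x \<in> A \<Longrightarrow> y \<in> A \<Longrightarrow> agree_on S (emb (d' x y)) (d x y)"
    using ex_approximating_metric[OF A S] by blast
  obtain f where f: "bij_betw f A {..<card A}"
    using ex_bij_betw_finite_nat[OF A(1)] by (auto simp: atLeast0LessThan)
  let ?g = "inv_into A f"
  define N where "N = Struct {..<card A} (\<lambda>s i j. d' (?g i) (?g j) \<le> s)"
  have "metric_on {..<card A} (\<lambda>i j. d' (?g i) (?g j))"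
    using bij_betw_inv_into[OF f] by (intro metric_on_inj_image[OF d'(1)]) (auto simp: bij_betw_def)
  then have "N \<in> finite_metric_structs"
    unfolding finite_metric_structs_def N_def by auto
  then have "N \<in> age U"
    using U unfolding is_Urysohn_def fraisse_limit_def by blast
  then obtain k where k: "embedding N U k"
    unfolding age_def by blast
  let ?h = "k \<circ> f"
  have f': "f x < card A" "?g (f x) = x" if "x \<in> A" for x
    using f that bij_betw_inv_into_left[OF f] by (auto simp: bij_betw_def)
  have h: "?h ` A \<subseteq> carrier U"
    using k f' unfolding embedding_def N_def by auto
  moreover have "agree_on S (DU (?h x) (?h y)) (d x y)" if xy: "x \<in> A" "y \<in> A" for x y
  proof -
    have "rel U s (?h x) (?h y) \<longleftrightarrow> d' x y \<le> s" for s
      using k f' xy unfolding embedding_def N_def by auto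
    then have "agree_on S (DU (?h x) (?h y)) (emb (d' x y))"
      using cut_metricD(2)[OF U(2), of "?h x" "?h y"] h xy unfolding agree_on_def emb_le_iff by blast
    then show ?thesis
      using d'(2)[OF xy] by (rule agree_on_trans)
  qed
  ultimately show ?thesis by blast
qed

section \<open>Intervals around cuts\<close>

text \<open>Membership is decided by comparison with the endpoints that come from \<open>'r\<close>,
  or with \<open>0\<close> in the case of \<open>Zero\<close>.\<close>

lemma interval_set_agree:
  assumes "valid_interval I"
  shows "\<exists>S. finite S \<and> (\<forall>\<alpha> \<beta>. agree_on S \<alpha> \<beta> \<longrightarrow> \<alpha> \<in> interval_set I \<longrightarrow> \<beta> \<in> interval_set I)"
proof (cases I)
  case Zero
  then show ?thesis
    using agree_on_zero[of "{0}"] by (intro exI[of _ "{0}"]) auto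
next
  case (Ioc r s)
  show ?thesis
  proof (cases "s \<in> range emb")
    case True
    then obtain t where "s = emb t" by blast
    then show ?thesis
      unfolding Ioc agree_on_def by (intro exI[of _ "{r, t}"]) (auto simp: not_le[symmetric])
  next
    case False
    then have "s = top" using assms Ioc by simp
    then show ?thesis
      unfolding Ioc agree_on_def by (intro exI[of _ "{r}"]) (auto simp: not_le[symmetric])
  qed
qed

text \<open>For finite \<open>S\<close> containing 0 this is the cell of \<alpha> in the partition
  of the cuts into \<open>{0}\<close> and the half-open intervals between neighbouring elements of
  \<open>S\<close>, the last one reaching up to \<open>top\<close>.\<close>

definition interval_around :: "'r::distance_monoid set \<Rightarrow> 'r cut \<Rightarrow> 'r interval" where
  "interval_around S \<alpha> = (if \<alpha> = 0 then Zero
     else Ioc (Max {s\<in>S. emb s < \<alpha>}) (if \<exists>s\<in>S. \<alpha> \<le> emb s then emb (Min {s\<in>S. \<alpha> \<le> emb s}) else top))"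

text \<open>No element of \<open>S\<close> lies strictly between the endpoints, so all members
  compare alike with \<open>S\<close>. For nonzero \<alpha>, \<open>0 \<in> S\<close> supplies a
  lower endpoint.\<close>

lemma interval_around:
  assumes S: "finite S" "0 \<in> S"
  shows "valid_interval (interval_around S \<alpha>)"
    and "\<alpha> \<in> interval_set (interval_around S \<alpha>)"
    and "\<beta> \<in> interval_set (interval_around S \<alpha>) \<Longrightarrow> agree_on S \<beta> \<alpha>"
proof -
  have "valid_interval (interval_around S \<alpha>) \<and> \<alpha> \<in> interval_set (interval_around S \<alpha>) \<and>
    (\<beta> \<in> interval_set (interval_around S \<alpha>) \<longrightarrow> agree_on S \<beta> \<alpha>)"
  proof (cases "\<alpha> = 0")
    case True
    then show ?thesis by (auto simp: interval_around_def)
  next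
    case False
    let ?L = "{s\<in>S. emb s < \<alpha>}" and ?R = "{s\<in>S. \<alpha> \<le> emb s}"
    define r t where "r = Max ?L" and "t = (if \<exists>s\<in>S. \<alpha> \<le> emb s then emb (Min ?R) else top)"
    have eq: "interval_around S \<alpha> = Ioc r t"
      using False by (simp add: interval_around_def r_def t_def)
    have "0 \<in> ?L"
      using False S(2) zero_le_dist[of \<alpha>] by (simp add: emb_zero less_le)
    then have "r \<in> ?L"
      unfolding r_def using S(1) by (intro Max_in) auto
    then have r: "emb r < \<alpha>" by simp
    have r': "s \<le> r" if "s \<in> S" "emb s < \<alpha>" for s
      unfolding r_def using S(1) that by (intro Max_ge) auto
    have t: "\<alpha> \<le> t \<and> t \<in> range emb \<union> {top} \<and> (\<forall>s\<in>S. \<alpha> \<le> emb s \<longrightarrow> t \<le> emb s)"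
    proof (cases "\<exists>s\<in>S. \<alpha> \<le> emb s")
      case True
      then have "Min ?R \<in> ?R"
        using S(1) by (intro Min_in) auto
      moreover have "Min ?R \<le> s" if "s \<in> S" "\<alpha> \<le> emb s" for s
        using S(1) that by (intro Min_le) auto
      ultimately show ?thesis
        unfolding t_def using True by (simp add: emb_le_iff)
    qed (simp add: t_def)
    have "agree_on S \<beta> \<alpha>" if "emb r < \<beta>" "\<beta> \<le> t"
      unfolding agree_on_def
    proof (intro ballI iffI)
      fix s assume s: "s \<in> S"
      show "\<beta> \<le> emb s" if "\<alpha> \<le> emb s"
        using t s that \<open>\<beta> \<le> t\<close> by (meson order_trans)
      show "\<alpha> \<le> emb s" if "\<beta> \<le> emb s"
      proof (rule ccontr)
        assume "\<not> \<alpha> \<le> emb s"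
        then have "emb s \<le> emb r"
          using r'[OF s] by (simp add: emb_le_iff)
        then show False
          using that \<open>emb r < \<beta>\<close> by simp
      qed
    qed
    moreover have "emb r < t"
      using r t less_le_trans by blast
    ultimately show ?thesis
      unfolding eq using r t by auto
  qed
  then show "valid_interval (interval_around S \<alpha>)"
    "\<alpha> \<in> interval_set (interval_around S \<alpha>)"
    "\<beta> \<in> interval_set (interval_around S \<alpha>) \<Longrightarrow> agree_on S \<beta> \<alpha>" by blast+
qed

section \<open>Limits of one-point extensions\<close>

text \<open>For each of the countably many conditions in turn, one passes to a subsequence on which
  its truth value is constant, and then to the diagonal.\<close>

lemma diagonal_eventually_constant:
  fixes Q :: "'c::countable \<Rightarrow> nat \<Rightarrow> bool"
  shows "\<exists>r. strict_mono r \<and> (\<forall>c. (\<forall>\<^sub>F k in sequentially. Q c (r k)) \<or> (\<forall>\<^sub>F k in sequentially. \<not> Q c (r k)))"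
proof -
  define P where "P n s \<longleftrightarrow> (\<forall>k. Q (from_nat n) (s k)) \<or> (\<forall>k. \<not> Q (from_nat n) (s k))" for n and s :: "nat \<Rightarrow> nat"
  have "\<exists>r. strict_mono r \<and> P n (s \<circ> r)" for n and s :: "nat \<Rightarrow> nat"
  proof (cases "infinite {k. Q (from_nat n) (s k)}")
    case True
    then show ?thesis
      using infinite_enumerate[OF True] unfolding P_def by fastforce
  next
    case False
    then have "infinite {k. \<not> Q (from_nat n) (s k)}"
      using finite_Collect_not by blast
    then show ?thesis
      using infinite_enumerate[of "{k. \<not> Q (from_nat n) (s k)}"] unfolding P_def by fastforce
  qed
  then interpret subseqs P by unfold_locales
  \<comment> \<open>Constancy is inherited by subsequences, and from index \<open>Suc n\<close> on
    the diagonal is a subsequence of the \<open>n\<close>-th selection.\<close>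
  have spec_P: "P n (diagseq \<circ> (+) (Suc n))" for n
    by (rule diagseq_holds) (auto simp: P_def)
  have const: "(\<forall>k. Q c (diagseq (Suc (to_nat c) + k))) \<or> (\<forall>k. \<not> Q c (diagseq (Suc (to_nat c) + k)))"
    for c using spec_P[of "to_nat c"] by (simp add: P_def)
  have "(\<forall>\<^sub>F k in sequentially. Q c (diagseq k)) \<or> (\<forall>\<^sub>F k in sequentially. \<not> Q c (diagseq k))" for c
  proof -
    have "\<forall>\<^sub>F k in sequentially. \<exists>l. k = Suc (to_nat c) + l"
      using eventually_ge_at_top[of "Suc (to_nat c)"] unfolding le_iff_add .
    then show ?thesis
      using const[of c] eventually_mono by (smt (verit, best))
  qed
  then show ?thesis
    using subseq_diagseq by blast
qed

text \<open>Compactness of the space of cuts: along a diagonal subsequence every comparison with an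
  element of \<open>'r\<close> stabilizes, and the stable comparisons define \<open>f\<close>. Each
  instance of a triangle inequality involves three comparisons, so it survives in the limit.\<close>

lemma one_point_extension_limit:
  fixes d :: "nat \<Rightarrow> nat \<Rightarrow> 'r::{distance_monoid, countable} cut"
  assumes lim: "\<And>s i j. i < n \<Longrightarrow> j < n \<Longrightarrow> \<forall>\<^sub>F k in sequentially. agree_on {s} (d' k i j) (d i j)"
    and tri: "\<And>k i j. i < n \<Longrightarrow> j < n \<Longrightarrow> triangle (d' k i j) (F k i) (F k j)"
  shows "\<exists>f r. strict_mono r \<and> (\<forall>i<n. \<forall>j<n. triangle (d i j) (f i) (f j)) \<and>
    (\<forall>i s. \<forall>\<^sub>F k in sequentially. agree_on {s} (F (r k) i) (f i))"
proof -
  obtain r where r: "strict_mono r"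
    and ev: "\<And>i s. (\<forall>\<^sub>F k in sequentially. F (r k) i \<le> emb s) \<or> (\<forall>\<^sub>F k in sequentially. \<not> F (r k) i \<le> emb s)"
    using diagonal_eventually_constant[of "\<lambda>(i, s) k. F k i \<le> emb s"] by auto
  have "\<exists>\<alpha>. \<forall>s. \<alpha> \<le> emb s \<longleftrightarrow> (\<forall>\<^sub>F k in sequentially. F (r k) i \<le> emb s)" for i
    unfolding le_emb_iff[of "F _ _"]
    by (rule cut_eq_of_levels) (auto elim!: eventually_mono intro: cut_up simp: cut_max)
  then obtain f where f: "\<And>i s. f i \<le> emb s \<longleftrightarrow> (\<forall>\<^sub>F k in sequentially. F (r k) i \<le> emb s)"
    by metis
  \<comment> \<open>By construction \<open>f\<close> records only the levels that eventually hold;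
    that every other level eventually fails is due to the choice of \<open>r\<close>.\<close>
  have f': "\<forall>\<^sub>F k in sequentially. agree_on {s} (F (r k) i) (f i)" for i s
    using ev[of i s]
  proof
    assume *: "\<forall>\<^sub>F k in sequentially. F (r k) i \<le> emb s"
    show ?thesis
      using * by (rule eventually_mono) (use * f in \<open>auto simp: agree_on_def\<close>)
  next
    assume *: "\<forall>\<^sub>F k in sequentially. \<not> F (r k) i \<le> emb s"
    have "\<not> f i \<le> emb s"
    proof
      assume "f i \<le> emb s"
      then have "\<forall>\<^sub>F k in sequentially. False"
        using * unfolding f by eventually_elim blast
      then show False by simp
    qed
    then show ?thesis
      using * by (auto simp: agree_on_def)
  qed
  have d: "\<forall>\<^sub>F k in sequentially. agree_on {s} (d' (r k) i j) (d i j)" if "i < n" "j < n" for s i j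
    using eventually_subseq[OF r lim[OF that]] .
  have "triangle (d i j) (f i) (f j)" if ij: "i < n" "j < n" for i j
  proof -
    have tri': "triangle (d' k i j) (F k i) (F k j)" for k
      using tri[OF ij] .
    have "d i j \<le> emb (t + u)" if *: "f i \<le> emb t" "f j \<le> emb u" for t u
    proof -
      \<comment> \<open>The claim does not depend on \<open>k\<close>; a single index at which all
        three agreements hold suffices.\<close>
      have "\<forall>\<^sub>F k in sequentially. d i j \<le> emb (t + u)"
        using f'[of t i] f'[of u j] d[OF ij, of "t + u"]
      proof eventually_elim
        case (elim k)
        then show ?case
          using * tri'[of "r k"] le_plus_cutD unfolding triangle_def agree_on_def by blast
      qed
      then show ?thesis by simp
    qed
    moreover have "f i \<le> emb (t + u)" if *: "d i j \<le> emb t" "f j \<le> emb u" for t u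
    proof -
      have "\<forall>\<^sub>F k in sequentially. f i \<le> emb (t + u)"
        using f'[of "t + u" i] f'[of u j] d[OF ij, of t]
      proof eventually_elim
        case (elim k)
        then show ?case
          using * tri'[of "r k"] le_plus_cutD unfolding triangle_def agree_on_def by blast
      qed
      then show ?thesis by simp
    qed
    moreover have "f j \<le> emb (t + u)" if *: "d i j \<le> emb t" "f i \<le> emb u" for t u
    proof -
      have "\<forall>\<^sub>F k in sequentially. f j \<le> emb (t + u)"
        using f'[of "t + u" j] f'[of u i] d[OF ij, of t]
      proof eventually_elim
        case (elim k)
        then show ?case
          using * tri'[of "r k"] le_plus_cutD unfolding triangle_def agree_on_def by blast
      qed
      then show ?thesis by simp
    qed
    ultimately show ?thesis
      unfolding triangle_def le_plus_cut_iff by blast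
  qed
  then show ?thesis
    using r f' by blast
qed

section \<open>Realizing one-point extensions\<close>

lemma metric_on_one_point_ext:
  assumes d: "metric_on {..<n} d" and f: "\<And>i. i < n \<Longrightarrow> 0 < f i"
    and tri: "\<And>i j. i < n \<Longrightarrow> j < n \<Longrightarrow> triangle (d i j) (f i) (f j)"
  shows "metric_on {..<Suc n} (one_point_ext n d f)"
proof -
  have pos: "f i \<noteq> 0" if "i < n" for i
    using f[OF that] by simp
  note D = metric_onD[OF d, unfolded lessThan_iff]
  show ?thesis
    unfolding metric_on_def
  proof (intro conjI ballI)
    fix x y assume "x \<in> {..<Suc n}" "y \<in> {..<Suc n}"
    then show "one_point_ext n d f x y = 0 \<longleftrightarrow> x = y" "one_point_ext n d f x y = one_point_ext n d f y x"
      using D(1,3)[of x y] pos by (auto simp: one_point_ext_def)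
  next
    fix x y z assume "x \<in> {..<Suc n}" "y \<in> {..<Suc n}" "z \<in> {..<Suc n}"
    then show "one_point_ext n d f x z \<le> one_point_ext n d f x y + one_point_ext n d f y z"
      using D(3)[of x y] D(4)[of x y z] tri[of x y] tri[of y z] tri[of x z]
      unfolding one_point_ext_def triangle_def by (auto simp: zero_le_dist add.commute)
  qed
qed

lemma extension_scheme_metric:
  "extension_scheme E \<Longrightarrow> metric_on {..<Suc (size_of E)} (ext_dist E)"
  unfolding extension_scheme_def by (intro metric_on_one_point_ext) auto

text \<open>The spaces \<open>d' k\<close> converge to the points \<open>a i\<close> of
  \<open>M\<close>, so a subsequence of their one-point extensions \<open>F k\<close> converges to a
  one-point extension \<open>f\<close> of these points. An extension axiom realizes \<open>f\<close>
  up to agreement on \<open>S\<close>, and late members of the subsequence agree on \<open>S\<close>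
  with \<open>f\<close>.\<close>

lemma one_point_extension_realized:
  fixes M :: "('r::{distance_monoid, countable}, 'm) lstruct" and a :: "nat \<Rightarrow> 'm"
  assumes c: "admissible_choice U c" and M: "model_of M (T_ax c)" "cut_metric M D"
    and a: "inj_on a {..<n}" "a ` {..<n} \<subseteq> carrier M"
    and lim: "\<And>s i j. i < n \<Longrightarrow> j < n \<Longrightarrow> \<forall>\<^sub>F k in sequentially. agree_on {s} (d' k i j) (D (a i) (a j))"
    and tri: "\<And>k i j. i < n \<Longrightarrow> j < n \<Longrightarrow> triangle (d' k i j) (F k i) (F k j)"
    and S: "finite S"
  shows "\<exists>y\<in>carrier M. \<exists>k. \<forall>i<n. agree_on S (D (a i) y) (F k i)"
proof -
  let ?d = "\<lambda>i j. D (a i) (a j)"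
  have evS: "\<forall>\<^sub>F k in sequentially. agree_on T (G k) \<alpha>"
    if "\<And>s. \<forall>\<^sub>F k in sequentially. agree_on {s} (G k) \<alpha>" "finite T" for G :: "nat \<Rightarrow> 'r cut" and T \<alpha>
    using eventually_ball_finite[OF that(2), of "\<lambda>k s. agree_on {s} (G k) \<alpha>"] that(1)
    by (auto simp: agree_on_def)
  have aM: "a i \<in> carrier M" if "i < n" for i
    using a(2) that by auto
  have d: "metric_on {..<n} ?d"
    by (rule metric_on_inj_image[OF cut_metricD(1)[OF M(2)] a])
  obtain f r where r: "strict_mono r"
    and f_tri: "\<And>i j. i < n \<Longrightarrow> j < n \<Longrightarrow> triangle (?d i j) (f i) (f j)"
    and f: "\<And>i s. \<forall>\<^sub>F k in sequentially. agree_on {s} (F (r k) i) (f i)"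
    using one_point_extension_limit[of n d' ?d F] lim tri by blast
  show ?thesis
  proof (cases "\<exists>i<n. f i = 0")
    \<comment> \<open>Not an extension scheme, as these require positive distances: the limit point is \<open>a i\<close>.\<close>
    case True
    then obtain i where i: "i < n" "f i = 0" by blast
    have "\<forall>\<^sub>F k in sequentially. F (r k) i = 0"
      using f[of 0 i] by (rule eventually_mono) (use agree_on_zero[of "{0}"] i in blast)
    moreover have "\<forall>\<^sub>F k in sequentially. \<forall>j\<in>{..<n}. agree_on S (d' (r k) i j) (?d i j)"
      using evS[OF eventually_subseq[OF r lim[OF i(1)]] S] by (intro eventually_ball_finite) auto
    ultimately have "\<forall>\<^sub>F k in sequentially. F (r k) i = 0 \<and> (\<forall>j\<in>{..<n}. agree_on S (d' (r k) i j) (?d i j))"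
      by (rule eventually_conj)
    then obtain k where k: "F (r k) i = 0" "\<And>j. j < n \<Longrightarrow> agree_on S (d' (r k) i j) (?d i j)"
      by (auto dest!: eventually_happens'[OF sequentially_bot])
    have "agree_on S (D (a j) (a i)) (F (r k) j)" if j: "j < n" for j
    proof -
      \<comment> \<open>The new point is at distance 0 from point \<open>i\<close>, so both have the
        same distance to \<open>j\<close>.\<close>
      have "F (r k) j = d' (r k) i j"
        using tri[OF i(1) j, of "r k"] k(1) unfolding triangle_def by (simp add: order_antisym)
      then show ?thesis
        using k(2)[OF j] metric_onD(3)[OF d, of i j] i(1) j by (simp add: agree_on_sym)
    qed
    then show ?thesis
      using aM[OF i(1)] by blast
  next
    case False
    let ?S = "insert 0 S"
    have S': "finite ?S" "0 \<in> ?S" using S by auto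
    let ?\<delta> = "one_point_ext n ?d f"
    \<comment> \<open>The prescribed approximation consists of cells of \<open>?S\<close>, so
      whatever refinement \<open>c\<close> chooses, realizing it forces agreement on
      \<open>S\<close>.\<close>
    define E where "E = Scheme n ?d f (\<lambda>i j. interval_around ?S (?\<delta> i j))"
    have pos: "0 < f i" if "i < n" for i
      using False that zero_le_dist[of "f i"] by (auto simp: less_le)
    have \<delta>: "metric_on {..<Suc n} ?\<delta>"
      by (rule metric_on_one_point_ext[OF d pos f_tri])
    have E: "extension_scheme E"
      unfolding extension_scheme_def approximation_def E_def scheme.sel
      using d pos f_tri interval_around(1,2)[OF S'] metric_onD(3)[OF \<delta>] by auto
    have sel: "size_of E = n" "dist_of E = ?d" "ext_of E = f" "appr_of E = (\<lambda>i j. interval_around ?S (?\<delta> i j))"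
      by (simp_all add: E_def)
    have \<Phi>: "approximation (Suc n) ?\<delta> (c E)" "refines (Suc n) (c E) (\<lambda>i j. interval_around ?S (?\<delta> i j))"
      using c[unfolded admissible_choice_def, rule_format, OF E] unfolding sel by blast+
    have \<Phi>': "interval_set (c E i j) \<subseteq> interval_set (interval_around ?S (?\<delta> i j))" if "i \<le> n" "j \<le> n" for i j
      using \<Phi>(2) that unfolding refines_def by (simp add: less_Suc_eq_le)
    have "holds M (ext_axiom n (c E))"
      using M(1) E unfolding model_of_def T_ax_def by (force simp: E_def)
    then have ax: "\<And>e. range e \<subseteq> carrier M \<Longrightarrow> \<forall>i<n. \<forall>j<n. D (e i) (e j) \<in> interval_set (c E i j) \<Longrightarrow>
      \<exists>y\<in>carrier M. \<forall>i<n. D (e i) y \<in> interval_set (c E i n)"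
      using \<Phi>(1) by (subst (asm) holds_ext_axiom[OF M(2)]) (auto simp: approximation_def less_Suc_eq_le)
    obtain m where m: "m \<in> carrier M"
      using M(1) unfolding model_of_def by blast
    \<comment> \<open>Environments are total; \<open>m\<close> fills the places from
      \<open>n\<close> on, also when \<open>n\<close> is 0.\<close>
    define e where "e i = (if i < n then a i else m)" for i
    have "\<forall>i<n. \<forall>j<n. D (e i) (e j) \<in> interval_set (c E i j)"
      using \<Phi>(1) unfolding approximation_def by (auto simp: e_def one_point_ext_def less_Suc_eq)
    then obtain y where y: "y \<in> carrier M" "\<And>i. i < n \<Longrightarrow> D (a i) y \<in> interval_set (c E i n)"
      using ax[of e] aM m by (auto simp: e_def image_subset_iff)
    have "agree_on S (D (a i) y) (f i)" if "i < n" for i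
    proof -
      have "D (a i) y \<in> interval_set (interval_around ?S (f i))"
        using \<Phi>'[of i n] y(2)[OF that] that by (auto simp: one_point_ext_def)
      then show ?thesis
        using interval_around(3)[OF S'] agree_on_mono subset_insertI by blast
    qed
    moreover have "\<forall>\<^sub>F k in sequentially. \<forall>i\<in>{..<n}. agree_on S (F (r k) i) (f i)"
      using evS[OF f S] by (intro eventually_ball_finite) auto
    then obtain k where "\<forall>i\<in>{..<n}. agree_on S (F (r k) i) (f i)"
      by (auto dest!: eventually_happens'[OF sequentially_bot])
    ultimately have "\<forall>i<n. agree_on S (D (a i) y) (F (r k) i)"
      using agree_on_trans agree_on_sym lessThan_iff by metis
    then show ?thesis
      using y(1) by blast
  qed
qed

section \<open>Axiomatization\<close>

lemma ex_env_in:
  assumes "A \<noteq> {}" "\<And>v. v \<in> V \<Longrightarrow> e v \<in> A"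
  shows "\<exists>e'. range e' \<subseteq> A \<and> (\<forall>v\<in>V. e' v = e v)"
proof -
  obtain a where "a \<in> A" using assms(1) by blast
  then show ?thesis
    using assms(2) by (intro exI[of _ "\<lambda>v. if v \<in> V then e v else a"]) auto
qed

section \<open>Consequences of quantifier elimination in \<open>U\<close>\<close>

lemma eliminates_quantifiersD:
  assumes "eliminates_quantifiers (Th U)"
  obtains \<psi> where "qfree \<psi>" "fv \<psi> \<subseteq> fv \<phi>" "\<And>e. range e \<subseteq> carrier U \<Longrightarrow> sat U e \<phi> \<longleftrightarrow> sat U e \<psi>"
proof -
  obtain \<psi> where \<psi>: "qfree \<psi>" "fv \<psi> \<subseteq> fv \<phi>" "univ_closure (Iff \<phi> \<psi>) \<in> Th U"
    using assms unfolding eliminates_quantifiers_def by blast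
  have "holds U (Iff \<phi> \<psi>)"
    using \<psi>(3) unfolding Th_def univ_closure_def by (simp only: mem_Collect_eq holds_ForallList)
  then have "sat U e \<phi> \<longleftrightarrow> sat U e \<psi>" if "range e \<subseteq> carrier U" for e
    unfolding holds_def using that by auto
  with \<psi>(1,2) show ?thesis by (rule that)
qed

text \<open>In \<open>U\<close>, a quantifier-free \<psi> says that some point satisfies the
  constraints \<Psi> towards the new point. If \<Phi> is fine enough on the old points, every tuple
  meeting it agrees on the constants of \<psi> with a copy of the scheme's points in
  \<open>U\<close>. That copy comes with a realization of the new point, so \<psi> holds of it and
  hence of the tuple.\<close>

lemma ex_admissible_approximation:
  fixes U :: "('r::{distance_monoid, countable}, 'u) lstruct"
  assumes U: "is_Urysohn U" and qe: "eliminates_quantifiers (Th U)" and E: "extension_scheme E"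
  shows "\<exists>\<Phi>. approximation (Suc (size_of E)) (ext_dist E) \<Phi> \<and> refines (Suc (size_of E)) \<Phi> (appr_of E) \<and>
    holds U (ext_axiom (size_of E) \<Phi>)"
proof -
  obtain D where D: "cut_metric U D"
    using T_MS_cut_metric[of U] Urysohn_T_MS[OF U] by blast
  define n where "n = size_of E"
  define \<delta> where "\<delta> = ext_dist E"
  define \<Psi> where "\<Psi> = appr_of E"
  have \<delta>: "metric_on {..<Suc n} \<delta>"
    using extension_scheme_metric[OF E] unfolding n_def \<delta>_def .
  have \<Psi>: "\<Psi> i j = \<Psi> j i" "valid_interval (\<Psi> i j)" "\<delta> i j \<in> interval_set (\<Psi> i j)" if "i \<le> n" "j \<le> n" for i j
    using E that unfolding extension_scheme_def approximation_def n_def \<delta>_def \<Psi>_def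
    by (auto simp: less_Suc_eq_le)
  obtain \<psi> where \<psi>: "qfree \<psi>" "fv \<psi> \<subseteq> fv (Exists n (BigConj [DIn i n (\<Psi> i n). i \<leftarrow> [0..<n]]))"
    "\<And>e. range e \<subseteq> carrier U \<Longrightarrow> sat U e (Exists n (BigConj [DIn i n (\<Psi> i n). i \<leftarrow> [0..<n]])) \<longleftrightarrow> sat U e \<psi>"
    using eliminates_quantifiersD[OF qe] by blast
  have fv: "fv \<psi> \<subseteq> {..<n}"
    using \<psi>(2) by (auto simp: fv_BigConj fv_DIn)
  have sat_\<psi>: "sat U e \<psi> \<longleftrightarrow> (\<exists>y\<in>carrier U. \<forall>i<n. D (e i) y \<in> interval_set (\<Psi> i n))"
    if e: "range e \<subseteq> carrier U" for e
    unfolding \<psi>(3)[OF e, symmetric] by (rule sat_Exists_DIn[OF D e]) (use \<Psi>(2) in simp)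
  have "\<exists>S. \<forall>i\<le>n. \<forall>j\<le>n. finite (S i j) \<and>
      (\<forall>\<alpha> \<beta>. agree_on (S i j) \<alpha> \<beta> \<longrightarrow> \<alpha> \<in> interval_set (\<Psi> i j) \<longrightarrow> \<beta> \<in> interval_set (\<Psi> i j))"
    using interval_set_agree[OF \<Psi>(2)] by metis
  then obtain S' where S'_fin: "\<And>i j. i \<le> n \<Longrightarrow> j \<le> n \<Longrightarrow> finite (S' i j)"
    and S': "\<And>i j \<alpha> \<beta>. i \<le> n \<Longrightarrow> j \<le> n \<Longrightarrow> agree_on (S' i j) \<alpha> \<beta> \<Longrightarrow> \<alpha> \<in> interval_set (\<Psi> i j) \<Longrightarrow> \<beta> \<in> interval_set (\<Psi> i j)"
    by blast
  \<comment> \<open>The constants of \<psi> serve to transfer \<psi> between tuples; the sets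
    \<open>S'\<close> ensure that agreement on \<open>S\<close> preserves membership in the
    intervals of \<Psi>.\<close>
  define S where "S = insert 0 (consts_of \<psi> \<union> (\<Union>i\<in>{..n}. \<Union>j\<in>{..n}. S' i j))"
  have S: "finite S" "0 \<in> S" "insert 0 (consts_of \<psi>) \<subseteq> S"
    unfolding S_def using S'_fin finite_consts_of[of \<psi>] by auto
  have agree_\<Psi>: "\<beta> \<in> interval_set (\<Psi> i j)" if "i \<le> n" "j \<le> n" "agree_on S (\<delta> i j) \<beta>" for i j \<beta>
  proof (rule S'[OF that(1,2) _ \<Psi>(3)[OF that(1,2)]])
    show "agree_on (S' i j) (\<delta> i j) \<beta>"
      by (rule agree_on_mono[OF that(3)]) (use that(1,2) in \<open>auto simp: S_def\<close>)
  qed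
  \<comment> \<open>Only the constraints between old points are shrunk: those towards the new point
    have to stay as \<psi> describes them.\<close>
  define \<Phi> where "\<Phi> i j = (if i < n \<and> j < n then interval_around S (\<delta> i j) else \<Psi> i j)" for i j
  have valid: "valid_interval (\<Phi> i j)" if "i \<le> n" "j \<le> n" for i j
    using interval_around(1)[OF S(1,2)] \<Psi>(2) that by (simp add: \<Phi>_def)
  have "approximation (Suc n) \<delta> \<Phi>"
    using valid interval_around(2)[OF S(1,2)] \<Psi>(1,3) metric_onD(3)[OF \<delta>]
    unfolding approximation_def by (auto simp: \<Phi>_def less_Suc_eq_le)
  moreover have "refines (Suc n) \<Phi> \<Psi>"
    using agree_\<Psi>[OF _ _ agree_on_sym[OF interval_around(3)[OF S(1,2)]]]
    unfolding refines_def by (auto simp: \<Phi>_def less_Suc_eq_le)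
  moreover have "holds U (ext_axiom n \<Phi>)"
  proof (subst holds_ext_axiom[OF D valid], assumption, assumption, intro allI impI)
    fix e assume e: "range e \<subseteq> carrier U" "\<forall>i<n. \<forall>j<n. D (e i) (e j) \<in> interval_set (\<Phi> i j)"
    obtain h where h: "h ` {..<Suc n} \<subseteq> carrier U"
      and h': "\<And>i j. i \<le> n \<Longrightarrow> j \<le> n \<Longrightarrow> agree_on S (D (h i) (h j)) (\<delta> i j)"
      using Urysohn_realizes[OF U D _ \<delta> S(1)] by (auto simp: less_Suc_eq_le)
    have h_in: "h i \<in> carrier U" if "i \<le> n" for i
      using h that by (simp add: image_subset_iff)
    \<comment> \<open>The minimum keeps all values in the carrier; on variables below
      \<open>n\<close> this is \<open>h\<close>.\<close>
    define e' where "e' i = h (min i n)" for i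
    have e': "range e' \<subseteq> carrier U"
      using h_in by (auto simp: e'_def)
    have "D (e' i) (h n) \<in> interval_set (\<Psi> i n)" if "i < n" for i
      using agree_\<Psi>[of i n] agree_on_sym[OF h'[of i n]] that by (simp add: e'_def)
    then have "sat U e' \<psi>"
      unfolding sat_\<psi>[OF e'] using h_in by blast
    moreover have "sat U e \<psi> \<longleftrightarrow> sat U e' \<psi>"
    proof (rule sat_qfree_agree[OF D e(1) D e' \<psi>(1)])
      fix v w assume "v \<in> fv \<psi>" "w \<in> fv \<psi>"
      then have vw: "v < n" "w < n" using fv by auto
      have "agree_on S (D (e v) (e w)) (\<delta> v w)"
        using e(2) vw interval_around(3)[OF S(1,2)] by (simp add: \<Phi>_def)
      moreover have "agree_on S (\<delta> v w) (D (e' v) (e' w))"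
        using agree_on_sym[OF h'[of v w]] vw by (simp add: e'_def)
      ultimately show "agree_on (insert 0 (consts_of \<psi>)) (D (e v) (e w)) (D (e' v) (e' w))"
        using agree_on_mono[OF agree_on_trans S(3)] by blast
    qed
    ultimately show "\<exists>y\<in>carrier U. \<forall>i<n. D (e i) y \<in> interval_set (\<Phi> i n)"
      using sat_\<psi>[OF e(1)] by (simp add: \<Phi>_def)
  qed
  ultimately show ?thesis
    unfolding n_def \<delta>_def \<Psi>_def by blast
qed

text \<open>This is the passage from \<open>U\<close> to \<open>M\<close> for one quantifier. Left
  to right needs one copy in \<open>U\<close> of a tuple with its witness; right to left needs a
  sequence of ever better copies, whose witnesses are pulled back by
  \<open>one_point_extension_realized\<close>.\<close>

lemma Exists_qfree_transfer:
  fixes U :: "('r::{distance_monoid, countable}, 'u) lstruct" and M :: "('r, 'm) lstruct"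
  assumes U: "is_Urysohn U" and c: "admissible_choice U c" and M: "model_of M (T_ax c)"
    and \<theta>: "qfree \<theta>" and \<psi>: "qfree \<psi>" "fv \<psi> \<subseteq> fv (Exists x \<theta>)"
    and eq: "\<And>e. range e \<subseteq> carrier U \<Longrightarrow> sat U e (Exists x \<theta>) \<longleftrightarrow> sat U e \<psi>"
    and e: "range e \<subseteq> carrier M"
  shows "sat M e (Exists x \<theta>) \<longleftrightarrow> sat M e \<psi>"
proof -
  obtain DU where DU: "cut_metric U DU"
    using T_MS_cut_metric[of U] Urysohn_T_MS[OF U] by blast
  obtain D where D: "cut_metric M D"
    using T_MS_cut_metric[of M] M unfolding model_of_def T_ax_def by blast
  note metric = cut_metricD(1)[OF D] and metric_U = cut_metricD(1)[OF DU]
  have realize: "\<exists>e'. range e' \<subseteq> carrier U \<and> (\<forall>v\<in>V. \<forall>w\<in>V. agree_on S (D (e v) (e w)) (DU (e' v) (e' w)))"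
    if e: "range e \<subseteq> carrier M" and V: "finite V" and S: "finite S" for e V S
  proof -
    obtain h where h: "h ` e ` V \<subseteq> carrier U" "\<forall>x\<in>e ` V. \<forall>y\<in>e ` V. agree_on S (DU (h x) (h y)) (D x y)"
      using Urysohn_realizes[OF U DU _ metric_on_subset[OF metric, of "e ` V"] S] e V by blast
    obtain e' where e': "range e' \<subseteq> carrier U" "\<forall>v\<in>V. e' v = h (e v)"
      using ex_env_in[OF Urysohn_nonempty[OF U], of V "h \<circ> e"] h(1) by auto
    then show ?thesis
      using h(2) by (intro exI[of _ e']) (simp add: agree_on_sym)
  qed
  have Ex: "sat N e (Exists x \<theta>) \<longleftrightarrow> (\<exists>y\<in>carrier N. sat N (e(x := y)) \<theta>)" for N :: "('r, 'n) lstruct" and e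
    by auto
  show ?thesis
  proof
    assume "sat M e (Exists x \<theta>)"
    then obtain y where y: "y \<in> carrier M" "sat M (e(x := y)) \<theta>"
      by auto
    let ?e = "e(x := y)" and ?V = "fv \<theta> \<union> fv \<psi>" and ?S = "insert 0 (consts_of \<theta> \<union> consts_of \<psi>)"
    have e_y: "range ?e \<subseteq> carrier M"
      by (rule range_upd[OF e y(1)])
    obtain e' where e': "range e' \<subseteq> carrier U"
      "\<And>v w. v \<in> ?V \<Longrightarrow> w \<in> ?V \<Longrightarrow> agree_on ?S (D (?e v) (?e w)) (DU (e' v) (e' w))"
      using realize[OF e_y, of ?V ?S] finite_fv finite_consts_of by (metis finite_UnI finite_insert)
    have "sat U e' \<theta>"
      using sat_qfree_agree[OF D e_y DU e'(1) \<theta>] agree_on_mono[OF e'(2)] y(2) by blast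
    then have "sat U e' (Exists x \<theta>)"
      using e'(1) by (auto intro!: bexI[of _ "e' x"])
    then have "sat U e' \<psi>"
      using eq[OF e'(1)] by blast
    then have "sat M ?e \<psi>"
      using sat_qfree_agree[OF D e_y DU e'(1) \<psi>(1)] agree_on_mono[OF e'(2)] by blast
    \<comment> \<open>The variable \<open>x\<close> is not free in \<psi>, so the value
      \<open>y\<close> is irrelevant.\<close>
    then show "sat M e \<psi>"
      using sat_cong[of \<psi> ?e e M] \<psi>(2) by (metis Diff_iff fun_upd_other fv.simps(1,4,5) insertI1 subsetD sup_bot_right)
  next
    assume sat_\<psi>: "sat M e \<psi>"
    let ?V = "fv \<theta> - {x}"
    \<comment> \<open>The images of \<open>{..k}\<close> under \<open>from_nat\<close> exhaust the
      countable \<open>'r\<close>, so the copies for growing \<open>k\<close> converge to the tuple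
      in \<open>M\<close>.\<close>
    let ?S = "\<lambda>k. insert 0 (consts_of \<theta> \<union> consts_of \<psi>) \<union> from_nat ` {..k}"
    have fin: "finite (?S k)" for k
      using finite_consts_of[of \<theta>] finite_consts_of[of \<psi>] by simp
    have V: "finite ?V" using finite_fv by blast
    \<comment> \<open>Different variables may have the same value, while the points of an extension
      scheme are distinct. Thus \<open>a\<close> enumerates the values, \<open>p\<close> picks a
      variable for each value, and \<open>q\<close> gives the index of the value of a
      variable.\<close>
    define n where "n = card (e ` ?V)"
    obtain a where a: "bij_betw a {..<n} (e ` ?V)"
      using ex_bij_betw_nat_finite[of "e ` ?V"] V by (auto simp: n_def atLeast0LessThan)
    have "\<exists>j\<in>?V. a i = e j" if "i < n" for i
      using a that by (auto simp: bij_betw_def)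
    then obtain p where p: "\<And>i. i < n \<Longrightarrow> p i \<in> ?V \<and> a i = e (p i)" by metis
    have "\<exists>i<n. a i = e v" if "v \<in> ?V" for v
      using a that unfolding bij_betw_def by (metis (no_types, lifting) imageE image_eqI lessThan_iff)
    then obtain q where q: "\<And>v. v \<in> ?V \<Longrightarrow> q v < n \<and> a (q v) = e v" by metis
    have "\<exists>e' b. range e' \<subseteq> carrier U \<and> b \<in> carrier U \<and> sat U (e'(x := b)) \<theta> \<and>
      (\<forall>v\<in>?V. \<forall>w\<in>?V. agree_on (?S k) (D (e v) (e w)) (DU (e' v) (e' w)))" for k
    proof -
      obtain e' where e': "range e' \<subseteq> carrier U"
        "\<And>v w. v \<in> ?V \<Longrightarrow> w \<in> ?V \<Longrightarrow> agree_on (?S k) (D (e v) (e w)) (DU (e' v) (e' w))"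
        using realize[OF e V fin[of k]] by (elim exE conjE) (rule that, assumption, blast)
      have "sat U e' \<psi>"
      proof (subst sat_qfree_agree[OF D e DU e'(1) \<psi>(1), symmetric])
        fix v w assume "v \<in> fv \<psi>" "w \<in> fv \<psi>"
        then show "agree_on (insert 0 (consts_of \<psi>)) (D (e v) (e w)) (DU (e' v) (e' w))"
          using \<psi>(2) by (intro agree_on_mono[OF e'(2)[of v w]]) auto
      qed (rule sat_\<psi>)
      then have "sat U e' (Exists x \<theta>)"
        using eq[OF e'(1)] by blast
      then obtain b where "b \<in> carrier U" "sat U (e'(x := b)) \<theta>" by auto
      then show ?thesis using e' by blast
    qed
    then obtain e' b where e': "\<And>k. range (e' k) \<subseteq> carrier U" "\<And>k. b k \<in> carrier U"
      "\<And>k. sat U ((e' k)(x := b k)) \<theta>"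
      and agree: "\<And>k v w. v \<in> ?V \<Longrightarrow> w \<in> ?V \<Longrightarrow> agree_on (?S k) (D (e v) (e w)) (DU (e' k v) (e' k w))"
      by metis
    have e'_in: "e' k v \<in> carrier U" for k v
      using e'(1) by blast
    have "\<exists>y\<in>carrier M. \<exists>k. \<forall>i<n. agree_on (insert 0 (consts_of \<theta>)) (D (a i) y) (DU (e' k (p i)) (b k))"
    proof (rule one_point_extension_realized[OF c M D, where d' = "\<lambda>k i j. DU (e' k (p i)) (e' k (p j))"])
      show "inj_on a {..<n}" "a ` {..<n} \<subseteq> carrier M"
        using a e by (auto simp: bij_betw_def)
      show "finite (insert 0 (consts_of \<theta>))"
        using finite_consts_of by simp
      show "triangle (DU (e' k (p i)) (e' k (p j))) (DU (e' k (p i)) (b k)) (DU (e' k (p j)) (b k))" for k i j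
        by (rule metric_on_triangle[OF metric_U e'_in e'_in e'(2)])
      show "\<forall>\<^sub>F k in sequentially. agree_on {s} (DU (e' k (p i)) (e' k (p j))) (D (a i) (a j))"
        if "i < n" "j < n" for s i j
        using eventually_ge_at_top[of "to_nat s"]
      proof eventually_elim
        case (elim k)
        then have "s \<in> ?S k"
          by (auto intro!: image_eqI[of _ _ "to_nat s"])
        then show ?case
          using agree_on_sym[OF agree_on_mono[OF agree]] p that by auto
      qed
    qed
    then obtain y k where y: "y \<in> carrier M"
      and agree_y: "\<And>i. i < n \<Longrightarrow> agree_on (insert 0 (consts_of \<theta>)) (D (a i) y) (DU (e' k (p i)) (b k))"
      by blast
    have agree_y': "agree_on (insert 0 (consts_of \<theta>)) (D (e v) y) (DU (e' k v) (b k))" if v: "v \<in> ?V" for v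
    proof -
      let ?i = "q v"
      have i: "?i < n" "p ?i \<in> ?V" "a ?i = e v" "e (p ?i) = e v"
        using q[OF v] p[of ?i] by auto
      \<comment> \<open>Since \<open>0\<close> lies in every \<open>?S k\<close>, variables with
        equal values under \<open>e\<close> have equal values under \<open>e' k\<close>; so
        agreement for the representative \<open>p (q v)\<close> carries over to
        \<open>v\<close>.\<close>
      have "D (e (p ?i)) (e v) = 0"
        using metric_onD(2)[OF metric, of "e v"] e i(4) by auto
      then have "DU (e' k (p ?i)) (e' k v) = 0"
        using agree_on_zero[OF agree[OF i(2) v, of k]] by blast
      then have "e' k (p ?i) = e' k v"
        using metric_onD(1)[OF metric_U] e'_in by blast
      then show ?thesis
        using agree_y[OF i(1)] i(3) by simp
    qed
    have "sat M (e(x := y)) \<theta> \<longleftrightarrow> sat U ((e' k)(x := b k)) \<theta>"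
    proof (rule sat_qfree_agree[OF D range_upd[OF e y] DU range_upd[OF e'(1,2)] \<theta>])
      fix v w assume vw: "v \<in> fv \<theta>" "w \<in> fv \<theta>"
      have "D y y = 0" "DU (b k) (b k) = 0" "D y (e w) = D (e w) y" "DU (b k) (e' k w) = DU (e' k w) (b k)"
        by (rule metric_onD[OF metric] metric_onD[OF metric_U]; use y e e'(2) e'_in in blast)+
      then show "agree_on (insert 0 (consts_of \<theta>)) (D ((e(x := y)) v) ((e(x := y)) w))
          (DU (((e' k)(x := b k)) v) (((e' k)(x := b k)) w))"
        using agree_y'[of v] agree_y'[of w] agree_on_mono[OF agree[of v w k], of "insert 0 (consts_of \<theta>)"] vw
        by auto
    qed
    then show "sat M e (Exists x \<theta>)"
      using e'(3) y by auto
  qed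
qed

text \<open>By induction the body of a quantifier may be replaced by the same quantifier-free
  formula in \<open>U\<close> and in \<open>M\<close>. Elimination in \<open>U\<close> then removes
  the quantifier, and \<open>Exists_qfree_transfer\<close> makes the resulting equivalence valid in
  \<open>M\<close>.\<close>

lemma qfree_equivalent_both:
  fixes U :: "('r::{distance_monoid, countable}, 'u) lstruct" and M :: "('r, 'm) lstruct"
  assumes U: "is_Urysohn U" and qe: "eliminates_quantifiers (Th U)"
    and c: "admissible_choice U c" and M: "model_of M (T_ax c)"
  shows "\<exists>\<psi>. qfree \<psi> \<and> fv \<psi> \<subseteq> fv \<phi> \<and>
    (\<forall>e. range e \<subseteq> carrier U \<longrightarrow> (sat U e \<phi> \<longleftrightarrow> sat U e \<psi>)) \<and>
    (\<forall>e. range e \<subseteq> carrier M \<longrightarrow> (sat M e \<phi> \<longleftrightarrow> sat M e \<psi>))"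
proof (induction \<phi>)
  case (Imp \<phi>1 \<phi>2)
  then obtain \<psi>1 \<psi>2 where "qfree \<psi>1" "fv \<psi>1 \<subseteq> fv \<phi>1" "qfree \<psi>2" "fv \<psi>2 \<subseteq> fv \<phi>2"
    "\<forall>e. range e \<subseteq> carrier U \<longrightarrow> (sat U e \<phi>1 \<longleftrightarrow> sat U e \<psi>1)"
    "\<forall>e. range e \<subseteq> carrier M \<longrightarrow> (sat M e \<phi>1 \<longleftrightarrow> sat M e \<psi>1)"
    "\<forall>e. range e \<subseteq> carrier U \<longrightarrow> (sat U e \<phi>2 \<longleftrightarrow> sat U e \<psi>2)"
    "\<forall>e. range e \<subseteq> carrier M \<longrightarrow> (sat M e \<phi>2 \<longleftrightarrow> sat M e \<psi>2)"
    by blast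
  then show ?case
    by (intro exI[of _ "Imp \<psi>1 \<psi>2"]) auto
next
  case (Forall x \<phi>)
  then obtain \<psi> where \<psi>: "qfree \<psi>" "fv \<psi> \<subseteq> fv \<phi>"
    "\<forall>e. range e \<subseteq> carrier U \<longrightarrow> (sat U e \<phi> \<longleftrightarrow> sat U e \<psi>)"
    "\<forall>e. range e \<subseteq> carrier M \<longrightarrow> (sat M e \<phi> \<longleftrightarrow> sat M e \<psi>)"
    by blast
  obtain \<chi> where \<chi>: "qfree \<chi>" "fv \<chi> \<subseteq> fv (Exists x (Neg \<psi>))"
    and \<chi>U: "\<And>e. range e \<subseteq> carrier U \<Longrightarrow> sat U e (Exists x (Neg \<psi>)) \<longleftrightarrow> sat U e \<chi>"
    using eliminates_quantifiersD[OF qe] by blast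
  have \<chi>M: "sat M e (Exists x (Neg \<psi>)) \<longleftrightarrow> sat M e \<chi>" if "range e \<subseteq> carrier M" for e
    by (rule Exists_qfree_transfer[OF U c M _ \<chi> \<chi>U that]) (use \<psi>(1) in simp_all)
  have "sat U e (Forall x \<phi>) \<longleftrightarrow> sat U e (Neg \<chi>)" if e: "range e \<subseteq> carrier U" for e
  proof -
    have "sat U (e(x := a)) \<phi> \<longleftrightarrow> sat U (e(x := a)) \<psi>" if "a \<in> carrier U" for a
      using \<psi>(3) range_upd[OF e that] by blast
    then show ?thesis
      using \<chi>U[OF e] by auto
  qed
  moreover have "sat M e (Forall x \<phi>) \<longleftrightarrow> sat M e (Neg \<chi>)" if e: "range e \<subseteq> carrier M" for e
  proof -
    have "sat M (e(x := a)) \<phi> \<longleftrightarrow> sat M (e(x := a)) \<psi>" if "a \<in> carrier M" for a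
      using \<psi>(4) range_upd[OF e that] by blast
    then show ?thesis
      using \<chi>M[OF e] by auto
  qed
  ultimately show ?case
    using \<chi> \<psi>(2) by (intro exI[of _ "Neg \<chi>"]) auto
next
  case Bot
  show ?case by (rule exI[of _ Bot]) simp
next
  case (Eq x y)
  show ?case by (rule exI[of _ "Eq x y"]) simp
next
  case (DLe x y s)
  show ?case by (rule exI[of _ "DLe x y s"]) simp
qed

text \<open>Being axiomatized means having the same models. The existence of an admissible choice
  keeps the statement about all choices from being vacuous.\<close>

theorem theorem6p14:
  fixes U :: "('r::{distance_monoid, countable}, 'u) lstruct"
  assumes "is_Urysohn U"
    and "eliminates_quantifiers (Th U)"
  shows "(\<exists>c. admissible_choice U c) \<and>
    (\<forall>c. admissible_choice U c \<longrightarrow>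
      (\<forall>M :: ('r, 'm) lstruct. model_of M (T_ax c) \<longleftrightarrow> model_of M (Th U)))"
proof (intro conjI allI impI iffI)
  show "\<exists>c. admissible_choice U c"
    unfolding admissible_choice_def using ex_admissible_approximation[OF assms] by metis
next
  fix c and M :: "('r, 'm) lstruct"
  assume c: "admissible_choice U c" and M: "model_of M (Th U)"
  have "T_MS \<subseteq> Th U"
    using Urysohn_T_MS[OF assms(1)] sentence_T_MS by (auto simp: Th_def)
  moreover have "ext_axiom (size_of E) (c E) \<in> Th U" if "extension_scheme E" for E
    using c that sentence_ext_axiom by (simp add: Th_def admissible_choice_def)
  ultimately have "T_ax c \<subseteq> Th U"
    unfolding T_ax_def by blast
  then show "model_of M (T_ax c)"
    using M unfolding model_of_def by blast
next
  fix c and M :: "('r, 'm) lstruct"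
  assume c: "admissible_choice U c" and M: "model_of M (T_ax c)"
  obtain DU where DU: "cut_metric U DU"
    using T_MS_cut_metric[of U] Urysohn_T_MS[OF assms(1)] by blast
  obtain D where D: "cut_metric M D"
    using T_MS_cut_metric[of M] M unfolding model_of_def T_ax_def by blast
  have "sat M e \<phi>" if \<phi>: "\<phi> \<in> Th U" and e: "range e \<subseteq> carrier M" for \<phi> e
  proof -
    obtain \<psi> where \<psi>: "qfree \<psi>" "fv \<psi> \<subseteq> fv \<phi>"
      "\<forall>e. range e \<subseteq> carrier U \<longrightarrow> (sat U e \<phi> \<longleftrightarrow> sat U e \<psi>)"
      "\<forall>e. range e \<subseteq> carrier M \<longrightarrow> (sat M e \<phi> \<longleftrightarrow> sat M e \<psi>)"
      using qfree_equivalent_both[OF assms c M] by blast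
    obtain u where "u \<in> carrier U"
      using Urysohn_nonempty[OF assms(1)] by blast
    define e' where "e' = (\<lambda>_::nat. u)"
    have e': "range e' \<subseteq> carrier U"
      using \<open>u \<in> carrier U\<close> by (auto simp: e'_def)
    have "sat U e' \<psi>"
      using \<phi> e' \<psi>(3) unfolding Th_def holds_def by blast
    moreover have "fv \<psi> = {}"
      using \<phi> \<psi>(2) unfolding Th_def sentence_def by blast
    \<comment> \<open>With no free variables there is no distance to compare, so \<psi> has the same
      truth value in \<open>U\<close> and \<open>M\<close>.\<close>
    ultimately have "sat M e \<psi>"
      using sat_qfree_agree[OF D e DU e' \<psi>(1)] by blast
    then show ?thesis
      using \<psi>(4) e by blast
  qed
  then show "model_of M (Th U)"
    using M unfolding model_of_def holds_def by blast
qed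

end
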